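(* Let $n\ge 1$ and $m\ge 1$ be integers and let $H_m(\mathbb B)$ be the analytic functional Hilbert space on the open unit ball $\mathbb B\subset\mathbb C^n$ with reproducing kernel $K_m(z,w)=(1-\langle z,w\rangle)^{-m}$. Let $T\in L(H_m(\mathbb B))$ be a bounded linear operator satisfying \[ M^{\prime *}_zTM^\prime_z = P_{{\rm Im}M^*_z}\Big(\oplus \sum^{m-1}_{j=0}(-1)^j\binom{m}{j+1}\sigma^j_{M_z}(T)\Big)P_{{\rm Im}M^*_z}. \] Let $T_0=\frac{1}{2\pi}\int_0^{2\pi}U(t)TU(t)^*\,dt$ and define \[ g=(T-T_0)(1),\qquad h=T^*(1). \] Then $T$ is a Toeplitz operator with pluriharmonic symbol $f=g+\overline{h}$, i.e. $Tp=T_gp+T_h^*p$ for all polynomials $p\in\mathbb C[z]$.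
   Context: $H_m(\mathbb B)=\{f=\sum_{\alpha\in\mathbb N^n}f_\alpha z^\alpha\in\mathcal O(\mathbb B):\ \|f\|^2=\sum_\alpha |f_\alpha|^2/\rho_m(\alpha)<\infty\}$ with $\rho_m(\alpha)=\frac{(m+|\alpha|-1)!}{\alpha!(m-1)!}$; the monomials are orthogonal and polynomials are dense. Let $\mathbb H_k$ denote the space of homogeneous polynomials of degree $k$, so $H_m(\mathbb B)$ is the orthogonal sum of the $\mathbb H_k$, and every $f$ has homogeneous expansion $f=\sum_k f_k$, $f_k\in\mathbb H_k$. $M_z:H_m(\mathbb B)^n\to H_m(\mathbb B)$, $(f_i)\mapsto\sum_i z_if_i$, is the row multiplication operator (it has closed range), $M_z^*:H_m(\mathbb B)\to H_m(\mathbb B)^n$, $f\mapsto (M_{z_i}^*f)_i$, is its adjoint, and $P_{{\rm Im}M_z^*}$ is the orthogonal projection of $H_m(\mathbb B)^n$ onto the closed range of $M_z^*$. Let $\delta\in L(H_m(\mathbb B))$ be the diagonal operator $\delta(\sum_k f_k)=f_0+\sum_{k\ge1}\frac{m+k-1}{k}f_k$, and define $M_z'=\delta M_z:H_m(\mathbb B)^n\to H_m(\mathbb B)$, with adjoint $M_z'^*$. For $X\in L(H_m(\mathbb B))$, $\sigma_{M_z}(X)=\sum_{i=1}^n M_{z_i}XM_{z_i}^*$, $\sigma^j_{M_z}$ is its $j$-th iterate ($\sigma^0_{M_z}(X)=X$), and $\oplus X$ denotes the operator $X\oplus\cdots\oplus X$ ($n$ copies) on $H_m(\mathbb B)^n$.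 $U(t)\in L(H_m(\mathbb B))$ is the unitary $(U(t)f)(z)=f(e^{it}z)$, $t\in\mathbb R$; the integral defining $T_0$ is a weak operator integral (i.e. $\langle T_0f,g\rangle=\frac1{2\pi}\int_0^{2\pi}\langle U(t)TU(t)^*f,g\rangle dt$). For $u\in H_m(\mathbb B)$, $T_u$ denotes the densely defined closed multiplication operator $D_u\to H_m(\mathbb B)$, $v\mapsto uv$, with domain $D_u=\{v\in H_m(\mathbb B): uv\in H_m(\mathbb B)\}\supset\mathbb C[z]$, and $T_u^*$ its Hilbert space adjoint; the polynomials lie in the domain of $T_u^*$ and $T_u^*z^\alpha=\sum_{0\le\beta\le\alpha}\frac{\rho_m(\alpha-\beta)}{\rho_m(\alpha)}\overline{u_\beta}z^{\alpha-\beta}$. A bounded operator $T$ on $H_m(\mathbb B)$ is called a Toeplitz operator with pluriharmonic symbol $f$ if there are $g,h\in H_m(\mathbb B)$ with $f=g+\overline h$ and $Tp=T_gp+T_h^*p$ for all $p\in\mathbb C[z]$. *)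

theory Defs
  imports "HOL-Analysis.Analysis"
begin

text \<open>Model of H_m(B) on the ball in C^n, n = CARD('n): an element f = sum f_alpha z^alpha
  is represented by its Taylor coefficient function alpha \<mapsto> f_alpha, multi-indices
  alpha being functions 'n \<Rightarrow> nat.\<close>

type_synonym 'n coeff = "('n \<Rightarrow> nat) \<Rightarrow> complex"

definition mabs :: "('n::finite \<Rightarrow> nat) \<Rightarrow> nat" where
  "mabs \<alpha> = (\<Sum>i\<in>UNIV. \<alpha> i)"

definition rho :: "nat \<Rightarrow> ('n::finite \<Rightarrow> nat) \<Rightarrow> real" where
  "rho m \<alpha> = fact (m + mabs \<alpha> - 1) / ((\<Prod>i\<in>UNIV. fact (\<alpha> i)) * fact (m - 1))"

definition Hm :: "nat \<Rightarrow> ('n::finite) coeff set" where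
  "Hm m = {f. (\<lambda>\<alpha>. (cmod (f \<alpha>))\<^sup>2 / rho m \<alpha>) summable_on UNIV}"

definition hinner :: "nat \<Rightarrow> ('n::finite) coeff \<Rightarrow> 'n coeff \<Rightarrow> complex" where
  "hinner m f g = (\<Sum>\<^sub>\<infinity>\<alpha>. f \<alpha> * cnj (g \<alpha>) / complex_of_real (rho m \<alpha>))"

definition hnorm :: "nat \<Rightarrow> ('n::finite) coeff \<Rightarrow> real" where
  "hnorm m f = sqrt (\<Sum>\<^sub>\<infinity>\<alpha>. (cmod (f \<alpha>))\<^sup>2 / rho m \<alpha>)"

text \<open>Bounded linear operators on H_m(B) (only their action on H_m(B) matters).\<close>
definition bop :: "nat \<Rightarrow> (('n::finite) coeff \<Rightarrow> 'n coeff) \<Rightarrow> bool" where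
  "bop m T \<longleftrightarrow> (\<forall>f\<in>Hm m. T f \<in> Hm m)
     \<and> (\<forall>f\<in>Hm m. \<forall>g\<in>Hm m. \<forall>c::complex. T (\<lambda>\<alpha>. f \<alpha> + c * g \<alpha>) = (\<lambda>\<alpha>. T f \<alpha> + c * T g \<alpha>))
     \<and> (\<exists>C. \<forall>f\<in>Hm m. hnorm m (T f) \<le> C * hnorm m f)"

definition Hn :: "nat \<Rightarrow> ('n::finite \<Rightarrow> 'n coeff) set" where
  "Hn m = {F. \<forall>i. F i \<in> Hm m}"

definition hninner :: "nat \<Rightarrow> ('n::finite \<Rightarrow> 'n coeff) \<Rightarrow> ('n \<Rightarrow> 'n coeff) \<Rightarrow> complex" where
  "hninner m F G = (\<Sum>i\<in>UNIV. hinner m (F i) (G i))"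

definition hnnorm :: "nat \<Rightarrow> ('n::finite \<Rightarrow> 'n coeff) \<Rightarrow> real" where
  "hnnorm m F = sqrt (\<Sum>i\<in>UNIV. (hnorm m (F i))\<^sup>2)"

definition adjH :: "nat \<Rightarrow> (('n::finite) coeff \<Rightarrow> 'n coeff) \<Rightarrow> 'n coeff \<Rightarrow> 'n coeff" where
  "adjH m A g = (THE c. c \<in> Hm m \<and> (\<forall>f\<in>Hm m. hinner m (A f) g = hinner m f c))"

definition adjHn :: "nat \<Rightarrow> (('n::finite \<Rightarrow> 'n coeff) \<Rightarrow> 'n coeff) \<Rightarrow> 'n coeff \<Rightarrow> ('n \<Rightarrow> 'n coeff)" where
  "adjHn m A g = (THE C. C \<in> Hn m \<and> (\<forall>F\<in>Hn m. hinner m (A F) g = hninner m F C))"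

definition Mzi :: "'n::finite \<Rightarrow> 'n coeff \<Rightarrow> 'n coeff" where
  "Mzi i f = (\<lambda>\<alpha>. if 1 \<le> \<alpha> i then f (\<alpha>(i := \<alpha> i - 1)) else 0)"

definition Mz :: "('n::finite \<Rightarrow> 'n coeff) \<Rightarrow> 'n coeff" where
  "Mz F = (\<lambda>\<alpha>. \<Sum>i\<in>UNIV. Mzi i (F i) \<alpha>)"

definition delta :: "nat \<Rightarrow> ('n::finite) coeff \<Rightarrow> 'n coeff" where
  "delta m f = (\<lambda>\<alpha>. if mabs \<alpha> = 0 then f \<alpha>
        else complex_of_real ((real m + real (mabs \<alpha>) - 1) / real (mabs \<alpha>)) * f \<alpha>)"

definition Mzp :: "nat \<Rightarrow> ('n::finite \<Rightarrow> 'n coeff) \<Rightarrow> 'n coeff" where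
  "Mzp m F = delta m (Mz F)"

definition sigmaMz :: "nat \<Rightarrow> (('n::finite) coeff \<Rightarrow> 'n coeff) \<Rightarrow> 'n coeff \<Rightarrow> 'n coeff" where
  "sigmaMz m X f = (\<lambda>\<alpha>. \<Sum>i\<in>UNIV. Mzi i (X (adjH m (Mzi i) f)) \<alpha>)"

definition Sop :: "nat \<Rightarrow> (('n::finite) coeff \<Rightarrow> 'n coeff) \<Rightarrow> 'n coeff \<Rightarrow> 'n coeff" where
  "Sop m T f = (\<lambda>\<alpha>. \<Sum>j<m. (-1) ^ j * of_nat (m choose (j + 1)) * ((sigmaMz m ^^ j) T) f \<alpha>)"

definition oplus_op :: "('a \<Rightarrow> 'a) \<Rightarrow> ('n \<Rightarrow> 'a) \<Rightarrow> ('n \<Rightarrow> 'a)" where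
  "oplus_op X F = (\<lambda>i. X (F i))"

definition closureHn :: "nat \<Rightarrow> ('n::finite \<Rightarrow> 'n coeff) set \<Rightarrow> ('n \<Rightarrow> 'n coeff) set" where
  "closureHn m V = {Y \<in> Hn m. \<forall>e>0. \<exists>v\<in>V. hnnorm m (\<lambda>i \<alpha>. Y i \<alpha> - v i \<alpha>) < e}"

definition projHn :: "nat \<Rightarrow> ('n::finite \<Rightarrow> 'n coeff) set \<Rightarrow> ('n \<Rightarrow> 'n coeff) \<Rightarrow> ('n \<Rightarrow> 'n coeff)" where
  "projHn m V F = (THE P. P \<in> V \<and> (\<forall>v\<in>V. hninner m (\<lambda>i \<alpha>. F i \<alpha> - P i \<alpha>) v = 0))"

definition PImMzadj :: "nat \<Rightarrow> ('n::finite \<Rightarrow> 'n coeff) \<Rightarrow> ('n \<Rightarrow> 'n coeff)" where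
  "PImMzadj m = projHn m (closureHn m {adjHn m Mz f | f. f \<in> Hm m})"

definition Ut :: "real \<Rightarrow> ('n::finite) coeff \<Rightarrow> 'n coeff" where
  "Ut t f = (\<lambda>\<alpha>. exp (\<i> * complex_of_real (t * real (mabs \<alpha>))) * f \<alpha>)"

definition T0 :: "nat \<Rightarrow> (('n::finite) coeff \<Rightarrow> 'n coeff) \<Rightarrow> 'n coeff \<Rightarrow> 'n coeff" where
  "T0 m T f = (THE y. y \<in> Hm m \<and> (\<forall>g\<in>Hm m.
      hinner m y g = integral {0..2*pi} (\<lambda>t. hinner m (Ut t (T (adjH m (Ut t) f))) g) / complex_of_real (2*pi)))"

definition one :: "('n::finite) coeff" where
  "one = (\<lambda>\<alpha>. if \<forall>i. \<alpha> i = 0 then 1 else 0)"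

definition cmult :: "('n::finite) coeff \<Rightarrow> 'n coeff \<Rightarrow> 'n coeff" where
  "cmult u v = (\<lambda>\<alpha>. \<Sum>\<beta>\<in>{\<beta>. \<forall>i. \<beta> i \<le> \<alpha> i}. u \<beta> * v (\<lambda>i. \<alpha> i - \<beta> i))"

definition domT :: "nat \<Rightarrow> ('n::finite) coeff \<Rightarrow> 'n coeff set" where
  "domT m u = {v \<in> Hm m. cmult u v \<in> Hm m}"

definition Tadj :: "nat \<Rightarrow> ('n::finite) coeff \<Rightarrow> 'n coeff \<Rightarrow> 'n coeff" where
  "Tadj m u q = (THE c. c \<in> Hm m \<and> (\<forall>v\<in>domT m u. hinner m (cmult u v) q = hinner m v c))"

definition is_poly :: "('n::finite) coeff \<Rightarrow> bool" where
  "is_poly p \<longleftrightarrow> finite {\<alpha>. p \<alpha> \<noteq> 0}"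

definition toeplitz_pluriharmonic :: "nat \<Rightarrow> (('n::finite) coeff \<Rightarrow> 'n coeff) \<Rightarrow> 'n coeff \<Rightarrow> 'n coeff \<Rightarrow> bool" where
  "toeplitz_pluriharmonic m T g h \<longleftrightarrow> bop m T \<and> g \<in> Hm m \<and> h \<in> Hm m \<and>
     (\<forall>p. is_poly p \<longrightarrow> T p = (\<lambda>\<alpha>. cmult g p \<alpha> + Tadj m h p \<alpha>))"

end

theory Submission
  imports Defs
begin

text \<open>Encode \<open>T\<close> by the coefficients \<open>y \<alpha> \<beta> = \<rho>(\<beta>) (T z\<^sup>\<beta>)\<^sub>\<alpha>\<close> of the kernel
  \<open>K\<^sub>T(z,w) = \<langle>T k\<^sub>w, k\<^sub>z\<rangle>\<close>, so that \<open>\<sigma>\<close> becomes multiplication by \<open>\<langle>z,w\<rangle>\<close>. Compressing the hypothesis by \<open>M\<^sub>z\<close>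
  and \<open>M\<^sub>z\<^sup>*\<close> gives \<open>Q T Q = T - (1 - \<sigma>)\<^sup>m(T)\<close> with \<open>Q\<close> the projection onto the complement of the constants, i.e.
  \<open>(1 - \<langle>z,w\<rangle>)\<^sup>m K\<^sub>T(z,w) = K\<^sub>T(z,0) + K\<^sub>T(0,w) - K\<^sub>T(0,0)\<close>. Dividing by \<open>(1 - \<langle>z,w\<rangle>)\<^sup>m\<close>, which is legitimate for
  formal power series, expresses every matrix entry of \<open>T\<close> through its first row and column,
  that is, through \<open>T\<^sup>* 1\<close> and \<open>T 1\<close>.\<close>

section \<open>Multi-indices and the space\<close>

text \<open>The factor \<rho>(\<beta>) in the encoding is forced: the adjoint of
  \<open>M_{z_i}\<close> sends z^\<beta> to \<rho>(\<beta> - e_i) / \<rho>(\<beta>) times z^(\<beta>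
  - e_i), so the weights cancel and \<sigma> just lowers both indices by e_i. The hypothesis leaves
  the row \<alpha> = 0 and the column \<beta> = 0 unconstrained; they are the free data. Since 1 /
  (1 - <z,w>)^m has only terms with equal exponents in z and w, a boundary entry spreads only along
  its diagonal (\<alpha> + \<gamma>, \<beta> + \<gamma>). Entries at incomparable indices therefore
  vanish, and the others have the shape of the matrix of T_g plus the adjoint of T_h. The corner
  entry (T 1)_0 lies in both the row and the column; subtracting T_0 1, which is the constant (T
  1)_0, makes it count once, inside the conjugate of h. Adjoints, projections and T_0 are definite
  descriptions, so each is computed by exhibiting its coefficients, verifying the defining identity
  and proving uniqueness.\<close>

definition zpow :: "('n::finite \<Rightarrow> nat) \<Rightarrow> 'n coeff" where
  "zpow \<beta> = (\<lambda>\<alpha>. if \<alpha> = \<beta> then 1 else 0)"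

lemma one_eq_zpow: "one = zpow (\<lambda>_. 0)"
  by (auto simp: one_def zpow_def fun_eq_iff)

abbreviation inc :: "'n \<Rightarrow> ('n \<Rightarrow> nat) \<Rightarrow> ('n \<Rightarrow> nat)" where
  "inc i \<alpha> \<equiv> \<alpha>(i := Suc (\<alpha> i))"

abbreviation dec :: "'n \<Rightarrow> ('n \<Rightarrow> nat) \<Rightarrow> ('n \<Rightarrow> nat)" where
  "dec i \<alpha> \<equiv> \<alpha>(i := \<alpha> i - 1)"

lemma inj_inc: "inj (inc i)"
proof (rule injI)
  fix \<alpha> \<beta> :: "'a \<Rightarrow> nat" assume eq: "inc i \<alpha> = inc i \<beta>"
  have "\<alpha> j = \<beta> j" for j using fun_cong[OF eq, of j] by (auto split: if_splits)
  then show "\<alpha> = \<beta>" by auto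
qed

lemma range_inc: "range (inc i) = {\<alpha>. 1 \<le> \<alpha> i}"
proof (intro set_eqI iffI)
  fix \<alpha> :: "'a \<Rightarrow> nat" assume "\<alpha> \<in> {\<alpha>. 1 \<le> \<alpha> i}"
  then have "\<alpha> = inc i (dec i \<alpha>)" by auto
  then show "\<alpha> \<in> range (inc i)" by blast
qed auto

lemma mabs_inc [simp]: "mabs (inc i \<alpha>) = Suc (mabs \<alpha>)"
proof -
  have "mabs (inc i \<alpha>) = Suc (\<alpha> i) + (\<Sum>j\<in>UNIV - {i}. \<alpha> j)"
    unfolding mabs_def by (subst sum.remove[of _ i]) auto
  moreover have "mabs \<alpha> = \<alpha> i + (\<Sum>j\<in>UNIV - {i}. \<alpha> j)"
    unfolding mabs_def by (subst sum.remove[of _ i]) auto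
  ultimately show ?thesis by simp
qed

lemma mabs_dec: "1 \<le> \<alpha> i \<Longrightarrow> Suc (mabs (dec i \<alpha>)) = mabs \<alpha>"
  by (subst mabs_inc[where i=i, symmetric]) auto

lemma mabs_eq_0_iff: "mabs \<alpha> = 0 \<longleftrightarrow> \<alpha> = (\<lambda>_. 0)"
  by (auto simp: mabs_def fun_eq_iff)

section \<open>Weights: recursion and monotonicity\<close>

lemma rho_pos [simp]: "0 < rho m \<alpha>"
  unfolding rho_def by (intro divide_pos_pos mult_pos_pos prod_pos) auto

lemma rho_nonneg [simp]: "0 \<le> rho m \<alpha>"
  by (rule less_imp_le) simp

lemma rho_neq_0 [simp]: "rho m \<alpha> \<noteq> 0"
  using rho_pos[of m \<alpha>] by linarith

lemma rho_0 [simp]: "rho m (\<lambda>_. 0) = 1"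
  by (simp add: rho_def mabs_def)

lemma rho_inc:
  assumes "1 \<le> m"
  shows "real (Suc (\<alpha> i)) * rho m (inc i \<alpha>) = (real m + real (mabs \<alpha>)) * rho m \<alpha>"
proof -
  have 1: "(\<Prod>j\<in>UNIV. fact (inc i \<alpha> j) :: real) = real (Suc (\<alpha> i)) * (\<Prod>j\<in>UNIV. fact (\<alpha> j))"
    by (subst (1 2) prod.remove[of _ i]) auto
  have 2: "(fact (m + Suc (mabs \<alpha>) - 1) :: real) = (real m + real (mabs \<alpha>)) * fact (m + mabs \<alpha> - 1)"
    using assms by (cases m) (auto simp: algebra_simps)
  have "s * (x * y / ((s * p) * q)) = x * (y / (p * q))" if "s \<noteq> 0" for s x y p q :: real
    using that by simp
  then show ?thesis unfolding rho_def mabs_inc 1 2 by simp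
qed

text \<open>The quotient is \<rho>(\<alpha> - e_i) / \<rho>(\<alpha>), the coefficient of the
  adjoint of \<open>M_{z_i}\<close> on z^\<alpha>. Both sides vanish at
  \<open>\<alpha> i = 0\<close>, so the identity can be summed over all coordinates.\<close>

lemma rho_dec:
  assumes "1 \<le> m"
  shows "(if 1 \<le> \<alpha> i then rho m (dec i \<alpha>) else 0) = real (\<alpha> i) / (real m + real (mabs \<alpha>) - 1) * rho m \<alpha>"
proof (cases "1 \<le> \<alpha> i")
  case True
  then have "inc i (dec i \<alpha>) = \<alpha>" "real (mabs \<alpha>) = real (mabs (dec i \<alpha>)) + 1"
    using mabs_dec[of \<alpha> i] by auto
  with rho_inc[OF assms, of "dec i \<alpha>" i] True assms show ?thesis
    by (simp add: field_simps of_nat_diff)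
qed auto

lemma rho_inc_mono: "1 \<le> m \<Longrightarrow> rho m \<alpha> \<le> rho m (inc i \<alpha>)"
proof -
  assume m: "1 \<le> m"
  have "\<alpha> i \<le> mabs \<alpha>" unfolding mabs_def by (rule member_le_sum) auto
  then have "real (Suc (\<alpha> i)) \<le> real m + real (mabs \<alpha>)" using m by linarith
  then have "real (Suc (\<alpha> i)) * rho m \<alpha> \<le> real (Suc (\<alpha> i)) * rho m (inc i \<alpha>)"
    unfolding rho_inc[OF m] by (rule mult_right_mono) simp
  then show ?thesis by simp
qed

text \<open>Since z^\<alpha> has squared norm 1 / \<rho>(\<alpha>), this makes multiplication by a
  monomial a contraction. The induction removes one unit from a positive coordinate of
  \<open>\<beta>\<close>.\<close>

lemma rho_mono:
  assumes m: "1 \<le> m" shows "rho m \<alpha> \<le> rho m (\<lambda>i. \<alpha> i + \<beta> i)"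
proof (induction "mabs \<beta>" arbitrary: \<beta>)
  case 0
  then show ?case using mabs_eq_0_iff[of \<beta>] by simp
next
  case (Suc k)
  then have "\<beta> \<noteq> (\<lambda>_. 0)" using mabs_eq_0_iff[of \<beta>] by auto
  then obtain i where i: "1 \<le> \<beta> i" by (auto simp: fun_eq_iff Suc_le_eq)
  have "(\<lambda>j. \<alpha> j + \<beta> j) = inc i (\<lambda>j. \<alpha> j + dec i \<beta> j)" using i by (auto simp: fun_eq_iff)
  moreover have "k = mabs (dec i \<beta>)" using Suc mabs_dec[of \<beta> i] i by auto
  ultimately show ?case
    using Suc(1)[of "dec i \<beta>"] rho_inc_mono[OF m, of "\<lambda>j. \<alpha> j + dec i \<beta> j" i] by simp
qed

section \<open>Membership in \<open>Hm\<close>, norm and inner product\<close>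

lemma Hm_finite_support:
  assumes "finite {\<alpha>. f \<alpha> \<noteq> 0}" shows "f \<in> Hm m"
proof -
  have "(\<lambda>\<alpha>. (cmod (f \<alpha>))\<^sup>2 / rho m \<alpha>) summable_on {\<alpha>. f \<alpha> \<noteq> 0}"
    using assms by (rule summable_on_finite)
  then show ?thesis unfolding Hm_def mem_Collect_eq
    by (rule summable_on_cong_neutral[THEN iffD1, rotated -1]) auto
qed

lemma zpow_Hm [simp]: "zpow \<beta> \<in> Hm m"
  by (rule Hm_finite_support) (auto simp: zpow_def)

lemma zero_Hm [simp]: "(\<lambda>_. 0) \<in> Hm m"
  by (simp add: Hm_def)

lemma scale_Hm: "f \<in> Hm m \<Longrightarrow> (\<lambda>\<alpha>. c * f \<alpha>) \<in> Hm m"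
  unfolding Hm_def by (auto simp: norm_mult power_mult_distrib dest: summable_on_cmult_right[where c="(cmod c)\<^sup>2"])

lemma add_Hm:
  assumes "f \<in> Hm m" "g \<in> Hm m" shows "(\<lambda>\<alpha>. f \<alpha> + g \<alpha>) \<in> Hm m"
proof -
  have "(\<lambda>\<alpha>. 2 * ((cmod (f \<alpha>))\<^sup>2 / rho m \<alpha> + (cmod (g \<alpha>))\<^sup>2 / rho m \<alpha>)) summable_on UNIV"
    using assms unfolding Hm_def by (intro summable_on_cmult_right summable_on_add) auto
  moreover have "(cmod (f \<alpha> + g \<alpha>))\<^sup>2 / rho m \<alpha> \<le> 2 * ((cmod (f \<alpha>))\<^sup>2 / rho m \<alpha> + (cmod (g \<alpha>))\<^sup>2 / rho m \<alpha>)" for \<alpha>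
  proof -
    have "(cmod (f \<alpha> + g \<alpha>))\<^sup>2 \<le> (cmod (f \<alpha>) + cmod (g \<alpha>))\<^sup>2"
      by (intro power_mono norm_triangle_ineq) auto
    also have "\<dots> \<le> 2 * ((cmod (f \<alpha>))\<^sup>2 + (cmod (g \<alpha>))\<^sup>2)"
      using zero_le_power2[of "cmod (f \<alpha>) - cmod (g \<alpha>)"] by (simp add: power2_eq_square algebra_simps)
    finally have "(cmod (f \<alpha> + g \<alpha>))\<^sup>2 / rho m \<alpha> \<le> 2 * ((cmod (f \<alpha>))\<^sup>2 + (cmod (g \<alpha>))\<^sup>2) / rho m \<alpha>"
      by (rule divide_right_mono) simp
    then show ?thesis by (simp add: add_divide_distrib)
  qed
  ultimately show ?thesis unfolding Hm_def mem_Collect_eq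
    by (rule summable_on_comparison_test) auto
qed

lemma diff_Hm: "f \<in> Hm m \<Longrightarrow> g \<in> Hm m \<Longrightarrow> (\<lambda>\<alpha>. f \<alpha> - g \<alpha>) \<in> Hm m"
  using add_Hm[OF _ scale_Hm[where c="-1"], of f m g] by simp

lemma sum_Hm: "finite I \<Longrightarrow> (\<And>i. i \<in> I \<Longrightarrow> f i \<in> Hm m) \<Longrightarrow> (\<lambda>\<alpha>. \<Sum>i\<in>I. f i \<alpha>) \<in> Hm m"
  by (induction I rule: finite_induct) (auto intro: add_Hm)

lemma multiplier_Hm:
  assumes "f \<in> Hm m" and d: "\<And>\<alpha>. cmod (d \<alpha>) \<le> C"
  shows "(\<lambda>\<alpha>. d \<alpha> * f \<alpha>) \<in> Hm m"
proof -
  have "(\<lambda>\<alpha>. C\<^sup>2 * ((cmod (f \<alpha>))\<^sup>2 / rho m \<alpha>)) summable_on UNIV"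
    using assms unfolding Hm_def by (intro summable_on_cmult_right) auto
  moreover have "(cmod (d \<alpha> * f \<alpha>))\<^sup>2 / rho m \<alpha> \<le> C\<^sup>2 * ((cmod (f \<alpha>))\<^sup>2 / rho m \<alpha>)" for \<alpha>
    using power_mono[OF d[of \<alpha>], of 2]
    by (auto simp: norm_mult power_mult_distrib intro!: divide_right_mono mult_right_mono)
  ultimately show ?thesis unfolding Hm_def mem_Collect_eq
    by (rule summable_on_comparison_test) auto
qed

text \<open>Young's inequality with a free parameter: \<epsilon> = 1 yields absolute summability of
  the inner product, and a well-chosen \<epsilon> later does the work of Cauchy-Schwarz.\<close>

lemma inner_term_le:
  assumes "0 < \<epsilon>"
  shows "cmod (f \<alpha> * cnj (g \<alpha>) / complex_of_real (rho m \<alpha>))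
    \<le> \<epsilon> / 2 * ((cmod (f \<alpha>))\<^sup>2 / rho m \<alpha>) + 1 / (2 * \<epsilon>) * ((cmod (g \<alpha>))\<^sup>2 / rho m \<alpha>)"
proof -
  have "0 \<le> (\<epsilon> * cmod (f \<alpha>) - cmod (g \<alpha>))\<^sup>2 / (2 * \<epsilon>)" using assms by simp
  then have "cmod (f \<alpha>) * cmod (g \<alpha>) \<le> \<epsilon> / 2 * (cmod (f \<alpha>))\<^sup>2 + 1 / (2 * \<epsilon>) * (cmod (g \<alpha>))\<^sup>2"
    using assms by (simp add: power2_eq_square field_simps)
  then have "cmod (f \<alpha>) * cmod (g \<alpha>) / rho m \<alpha> \<le> (\<epsilon> / 2 * (cmod (f \<alpha>))\<^sup>2 + 1 / (2 * \<epsilon>) * (cmod (g \<alpha>))\<^sup>2) / rho m \<alpha>"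
    by (rule divide_right_mono) simp
  then show ?thesis by (simp add: norm_mult norm_divide add_divide_distrib)
qed

lemma inner_abs_summable:
  assumes "f \<in> Hm m" "g \<in> Hm m"
  shows "(\<lambda>\<alpha>. cmod (f \<alpha> * cnj (g \<alpha>) / complex_of_real (rho m \<alpha>))) summable_on UNIV"
proof (rule summable_on_comparison_test)
  show "(\<lambda>\<alpha>. 1 / 2 * ((cmod (f \<alpha>))\<^sup>2 / rho m \<alpha>) + 1 / (2 * 1) * ((cmod (g \<alpha>))\<^sup>2 / rho m \<alpha>)) summable_on UNIV"
    using assms unfolding Hm_def by (intro summable_on_add summable_on_cmult_right) auto
qed (use inner_term_le[of 1] in auto)

lemma inner_summable:
  assumes "f \<in> Hm m" "g \<in> Hm m"
  shows "(\<lambda>\<alpha>. f \<alpha> * cnj (g \<alpha>) / complex_of_real (rho m \<alpha>)) summable_on UNIV"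
  by (rule abs_summable_summable[OF inner_abs_summable[OF assms]])

lemma hnorm_sq: "(hnorm m f)\<^sup>2 = (\<Sum>\<^sub>\<infinity>\<alpha>. (cmod (f \<alpha>))\<^sup>2 / rho m \<alpha>)"
  unfolding hnorm_def by (rule real_sqrt_pow2) (auto intro: infsum_nonneg)

lemma hnorm_nonneg [simp]: "0 \<le> hnorm m f"
  unfolding hnorm_def by (auto intro: infsum_nonneg)

lemma hinner_self:
  assumes "f \<in> Hm m" shows "hinner m f f = complex_of_real ((hnorm m f)\<^sup>2)"
proof -
  have "((\<lambda>\<alpha>. (cmod (f \<alpha>))\<^sup>2 / rho m \<alpha>) has_sum (hnorm m f)\<^sup>2) UNIV"
    using assms unfolding hnorm_sq Hm_def by (intro has_sum_infsum) simp
  from has_sum_of_real[OF this, where 'a=complex]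
  have "((\<lambda>\<alpha>. f \<alpha> * cnj (f \<alpha>) / complex_of_real (rho m \<alpha>)) has_sum complex_of_real ((hnorm m f)\<^sup>2)) UNIV"
    by (simp del: of_real_power add: complex_norm_square of_real_divide)
  then show ?thesis unfolding hinner_def by (rule infsumI)
qed

lemma hinner_le:
  assumes "f \<in> Hm m" "g \<in> Hm m" "0 < \<epsilon>"
  shows "cmod (hinner m f g) \<le> \<epsilon> / 2 * (hnorm m f)\<^sup>2 + 1 / (2 * \<epsilon>) * (hnorm m g)\<^sup>2"
proof -
  have f: "(\<lambda>\<alpha>. \<epsilon> / 2 * ((cmod (f \<alpha>))\<^sup>2 / rho m \<alpha>)) summable_on UNIV"
    and g: "(\<lambda>\<alpha>. 1 / (2 * \<epsilon>) * ((cmod (g \<alpha>))\<^sup>2 / rho m \<alpha>)) summable_on UNIV"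
    using assms unfolding Hm_def by (intro summable_on_cmult_right; simp)+
  have "cmod (hinner m f g) \<le> (\<Sum>\<^sub>\<infinity>\<alpha>. cmod (f \<alpha> * cnj (g \<alpha>) / complex_of_real (rho m \<alpha>)))"
    unfolding hinner_def by (rule norm_infsum_bound[OF inner_abs_summable[OF assms(1,2)]])
  also have "\<dots> \<le> (\<Sum>\<^sub>\<infinity>\<alpha>. \<epsilon> / 2 * ((cmod (f \<alpha>))\<^sup>2 / rho m \<alpha>) + 1 / (2 * \<epsilon>) * ((cmod (g \<alpha>))\<^sup>2 / rho m \<alpha>))"
    using inner_abs_summable[OF assms(1,2)] summable_on_add[OF f g] inner_term_le[OF assms(3)]
    by (rule infsum_mono)
  also have "\<dots> = \<epsilon> / 2 * (hnorm m f)\<^sup>2 + 1 / (2 * \<epsilon>) * (hnorm m g)\<^sup>2"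
    unfolding infsum_add[OF f g] hnorm_sq infsum_cmult_right' ..
  finally show ?thesis .
qed

lemma hinner_add_left:
  assumes "f \<in> Hm m" "g \<in> Hm m" "k \<in> Hm m"
  shows "hinner m (\<lambda>\<alpha>. f \<alpha> + g \<alpha>) k = hinner m f k + hinner m g k"
  unfolding hinner_def infsum_add[OF inner_summable[OF assms(1,3)] inner_summable[OF assms(2,3)], symmetric]
  by (rule infsum_cong) (simp add: field_simps)

lemma hinner_scale_left: "hinner m (\<lambda>\<alpha>. c * f \<alpha>) k = c * hinner m f k"
  unfolding hinner_def infsum_cmult_right'[symmetric] by (rule infsum_cong) simp

lemma hinner_diff_left:
  assumes "f \<in> Hm m" "g \<in> Hm m" "k \<in> Hm m"
  shows "hinner m (\<lambda>\<alpha>. f \<alpha> - g \<alpha>) k = hinner m f k - hinner m g k"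
  using hinner_add_left[OF assms(1) scale_Hm[OF assms(2), of "-1"] assms(3)]
  unfolding hinner_scale_left by simp

lemma hinner_sum_left:
  assumes "finite I" "\<And>i. i \<in> I \<Longrightarrow> f i \<in> Hm m" "k \<in> Hm m"
  shows "hinner m (\<lambda>\<alpha>. \<Sum>i\<in>I. f i \<alpha>) k = (\<Sum>i\<in>I. hinner m (f i) k)"
  using assms(1,2)
proof (induction I rule: finite_induct)
  case empty
  show ?case by (simp add: hinner_def)
next
  case (insert i I)
  then show ?case using sum_Hm[of I f m] assms(3) by (simp add: hinner_add_left)
qed

lemma hinner_cnj: "hinner m f g = cnj (hinner m g f)"
  unfolding hinner_def infsum_cnj[symmetric] by (rule infsum_cong) simp

lemma hinner_diff_right:
  assumes "f \<in> Hm m" "g \<in> Hm m" "k \<in> Hm m"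
  shows "hinner m k (\<lambda>\<alpha>. f \<alpha> - g \<alpha>) = hinner m k f - hinner m k g"
  by (subst (1 2 3) hinner_cnj) (simp add: hinner_diff_left[OF assms])

lemma hinner_finite:
  assumes "finite A" "\<And>\<alpha>. \<alpha> \<notin> A \<Longrightarrow> f \<alpha> = 0 \<or> g \<alpha> = 0"
  shows "hinner m f g = (\<Sum>\<alpha>\<in>A. f \<alpha> * cnj (g \<alpha>) / complex_of_real (rho m \<alpha>))"
proof -
  have "hinner m f g = (\<Sum>\<^sub>\<infinity>\<alpha>\<in>A. f \<alpha> * cnj (g \<alpha>) / complex_of_real (rho m \<alpha>))"
    unfolding hinner_def by (rule infsum_cong_neutral) (use assms(2) in auto)
  then show ?thesis using assms(1) by simp
qed

lemma hinner_zpow_right: "hinner m f (zpow \<beta>) = f \<beta> / complex_of_real (rho m \<beta>)"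
  by (subst hinner_finite[of "{\<beta>}"]) (auto simp: zpow_def)

lemma hinner_zpow_left: "hinner m (zpow \<beta>) f = cnj (f \<beta>) / complex_of_real (rho m \<beta>)"
  by (subst hinner_finite[of "{\<beta>}"]) (auto simp: zpow_def)

lemma hnorm_coeff_le:
  assumes "f \<in> Hm m" shows "(cmod (f \<alpha>))\<^sup>2 / rho m \<alpha> \<le> (hnorm m f)\<^sup>2"
proof -
  have "(\<Sum>\<beta>\<in>{\<alpha>}. (cmod (f \<beta>))\<^sup>2 / rho m \<beta>) \<le> (hnorm m f)\<^sup>2"
    unfolding hnorm_sq by (rule finite_sum_le_infsum) (use assms in \<open>auto simp: Hm_def\<close>)
  then show ?thesis by simp
qed

lemma hnorm_eq_0_imp:
  assumes "f \<in> Hm m" "hnorm m f = 0" shows "f \<alpha> = 0"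
  using hnorm_coeff_le[OF assms(1), of \<alpha>] assms(2) rho_pos[of m \<alpha>]
  by (simp add: field_simps)

lemma Hm_eqI_hinner:
  assumes "\<And>\<beta>. hinner m c (zpow \<beta>) = hinner m d (zpow \<beta>)" shows "c = d"
  using assms by (auto simp: hinner_zpow_right)

text \<open>The adjoint is a definite description, so a competitor has to be excluded: testing
  against monomials recovers each of its coefficients.\<close>

lemma adjH_eqI:
  assumes "c \<in> Hm m" "\<And>f. f \<in> Hm m \<Longrightarrow> hinner m (A f) g = hinner m f c"
  shows "adjH m A g = c"
  unfolding adjH_def
proof (rule the_equality)
  fix d assume d: "d \<in> Hm m \<and> (\<forall>f\<in>Hm m. hinner m (A f) g = hinner m f d)"
  show "d = c"
  proof
    fix \<beta>
    have "hinner m (zpow \<beta>) d = hinner m (zpow \<beta>) c" using d assms(2) by simp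
    then show "d \<beta> = c \<beta>" by (simp add: hinner_zpow_left)
  qed
qed (use assms in auto)

section \<open>Shifts, adjoints and projections\<close>

text \<open>The function is z^\<alpha> h. It is supported on the range of the injective translation
  by \<open>\<alpha>\<close>, where reindexing leaves only a comparison of weights.\<close>

lemma shift_Hm:
  assumes m: "1 \<le> m" and h: "h \<in> Hm m"
  shows "(\<lambda>\<gamma>. if \<forall>i. \<alpha> i \<le> \<gamma> i then h (\<lambda>i. \<gamma> i - \<alpha> i) else 0) \<in> Hm m" (is "?g \<in> _")
proof -
  define s where "s = (\<lambda>(\<beta>::'a \<Rightarrow> nat) i. \<beta> i + \<alpha> i)"
  have inj: "inj s" by (rule injI) (auto simp: s_def fun_eq_iff)
  have zero: "?g \<gamma> = 0" if "\<gamma> \<notin> range s" for \<gamma>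
  proof (rule ccontr)
    assume "?g \<gamma> \<noteq> 0"
    then have "\<gamma> = s (\<lambda>i. \<gamma> i - \<alpha> i)" by (auto simp: s_def fun_eq_iff split: if_splits)
    with that show False by blast
  qed
  have "(\<lambda>\<beta>. (cmod (h \<beta>))\<^sup>2 / rho m (s \<beta>)) summable_on UNIV"
  proof (rule summable_on_comparison_test)
    show "(\<lambda>\<beta>. (cmod (h \<beta>))\<^sup>2 / rho m \<beta>) summable_on UNIV" using h by (simp add: Hm_def)
    show "(cmod (h \<beta>))\<^sup>2 / rho m (s \<beta>) \<le> (cmod (h \<beta>))\<^sup>2 / rho m \<beta>" for \<beta>
      unfolding s_def by (rule divide_left_mono) (auto intro: rho_mono[OF m])
  qed auto
  also have "(\<lambda>\<beta>. (cmod (h \<beta>))\<^sup>2 / rho m (s \<beta>)) = (\<lambda>\<gamma>. (cmod (?g \<gamma>))\<^sup>2 / rho m \<gamma>) \<circ> s"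
    by (auto simp: s_def)
  finally have "(\<lambda>\<gamma>. (cmod (?g \<gamma>))\<^sup>2 / rho m \<gamma>) summable_on range s"
    using summable_on_reindex[OF inj] by blast
  then have "(\<lambda>\<gamma>. (cmod (?g \<gamma>))\<^sup>2 / rho m \<gamma>) summable_on UNIV"
    by (rule summable_on_cong_neutral[THEN iffD1, rotated -1]) (use zero in auto)
  then show ?thesis by (simp add: Hm_def)
qed

lemma Mzi_Hm:
  assumes "1 \<le> m" "f \<in> Hm m" shows "Mzi i f \<in> Hm m"
proof -
  have "(\<lambda>j. \<alpha> j - (if j = i then 1 else 0)) = dec i \<alpha>" for \<alpha> :: "'a \<Rightarrow> nat" by auto
  moreover have "(\<forall>j. (if j = i then 1 else 0) \<le> \<alpha> j) = (1 \<le> \<alpha> i)" for \<alpha> :: "'a \<Rightarrow> nat" by auto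
  ultimately show ?thesis
    using shift_Hm[OF assms, of "\<lambda>j. if j = i then 1 else 0"] by (simp only: Mzi_def)
qed

text \<open>The adjoint of \<open>Mzi i\<close> in coefficients; for m \<ge> 1 the factor is
  \<rho>(\<alpha>) / \<rho>(\<alpha> + e_i).\<close>

definition bshift :: "nat \<Rightarrow> 'n::finite \<Rightarrow> 'n coeff \<Rightarrow> 'n coeff" where
  "bshift m i f = (\<lambda>\<alpha>. complex_of_real (real (Suc (\<alpha> i)) / (real m + real (mabs \<alpha>))) * f (inc i \<alpha>))"

lemma rho_ratio:
  assumes "1 \<le> m"
  shows "real (Suc (\<alpha> i)) / (real m + real (mabs \<alpha>)) / rho m \<alpha> = 1 / rho m (inc i \<alpha>)"
proof -
  have "real m + real (mabs \<alpha>) \<noteq> 0" using assms by linarith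
  then have "x / (real m + real (mabs \<alpha>)) / p = 1 / q" if "x * q = (real m + real (mabs \<alpha>)) * p" "q \<noteq> 0" "p \<noteq> 0" for x p q
    using that by (simp add: divide_simps mult.commute)
  then show ?thesis using rho_inc[OF assms, of \<alpha> i] by simp
qed

lemma bshift_Hm:
  assumes m: "1 \<le> m" and f: "f \<in> Hm m" shows "bshift m i f \<in> Hm m"
proof -
  have "(\<lambda>\<alpha>. (cmod (f \<alpha>))\<^sup>2 / rho m \<alpha>) summable_on range (inc i)"
    using f unfolding Hm_def by (auto intro: summable_on_subset_banach)
  then have s: "(\<lambda>\<alpha>. (cmod (f (inc i \<alpha>)))\<^sup>2 / rho m (inc i \<alpha>)) summable_on UNIV"
    by (subst (asm) summable_on_reindex[OF inj_inc]) (simp add: o_def)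
  have "(cmod (bshift m i f \<alpha>))\<^sup>2 / rho m \<alpha> \<le> (cmod (f (inc i \<alpha>)))\<^sup>2 / rho m (inc i \<alpha>)" for \<alpha>
  proof -
    define r where "r = real (Suc (\<alpha> i)) / (real m + real (mabs \<alpha>))"
    have "\<alpha> i \<le> mabs \<alpha>" unfolding mabs_def by (rule member_le_sum) auto
    then have r: "0 \<le> r" "r \<le> 1" using m by (auto simp: r_def)
    have "(cmod (bshift m i f \<alpha>))\<^sup>2 / rho m \<alpha> = r\<^sup>2 * (cmod (f (inc i \<alpha>)))\<^sup>2 / rho m \<alpha>"
      unfolding bshift_def r_def[symmetric] by (simp only: norm_mult norm_of_real power_mult_distrib power2_abs)
    \<comment> \<open>One factor \<open>r\<close> exchanges the weight at \<open>\<alpha>\<close>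
      for the weight at \<open>inc i \<alpha>\<close>; the other is at most 1 and is
      discarded.\<close>
    also have "\<dots> = r * (cmod (f (inc i \<alpha>)))\<^sup>2 * (r / rho m \<alpha>)"
      by (simp add: power2_eq_square)
    also have "\<dots> = r * ((cmod (f (inc i \<alpha>)))\<^sup>2 / rho m (inc i \<alpha>))"
      unfolding rho_ratio[OF m, of \<alpha> i, folded r_def] by simp
    also have "\<dots> \<le> 1 * ((cmod (f (inc i \<alpha>)))\<^sup>2 / rho m (inc i \<alpha>))"
      using r by (intro mult_right_mono) auto
    finally show ?thesis by simp
  qed
  then show ?thesis unfolding Hm_def mem_Collect_eq
    by (intro summable_on_comparison_test[OF s]) auto
qed

lemma hinner_Mzi:
  assumes m: "1 \<le> m" shows "hinner m (Mzi i f) g = hinner m f (bshift m i g)"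
proof -
  have "hinner m (Mzi i f) g = (\<Sum>\<^sub>\<infinity>\<alpha>\<in>range (inc i). Mzi i f \<alpha> * cnj (g \<alpha>) / complex_of_real (rho m \<alpha>))"
    unfolding hinner_def range_inc by (rule infsum_cong_neutral) (auto simp: Mzi_def)
  also have "\<dots> = (\<Sum>\<^sub>\<infinity>\<alpha>. f \<alpha> * cnj (g (inc i \<alpha>)) * complex_of_real (1 / rho m (inc i \<alpha>)))"
    by (subst infsum_reindex[OF inj_inc]) (simp add: o_def Mzi_def)
  also have "\<dots> = hinner m f (bshift m i g)"
    unfolding hinner_def bshift_def rho_ratio[OF m, symmetric] by (rule infsum_cong) simp
  finally show ?thesis .
qed

lemma adjH_Mzi:
  assumes "1 \<le> m" "g \<in> Hm m" shows "adjH m (Mzi i) g = bshift m i g"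
  by (rule adjH_eqI) (use assms in \<open>auto simp: bshift_Hm hinner_Mzi\<close>)

lemma delta_Hm:
  assumes m: "1 \<le> m" and f: "f \<in> Hm m" shows "delta m f \<in> Hm m"
proof -
  let ?d = "\<lambda>\<alpha>. if mabs \<alpha> = 0 then 1 else complex_of_real ((real m + real (mabs \<alpha>) - 1) / real (mabs \<alpha>))"
  \<comment> \<open>The factor at degree k \<ge> 1 is 1 + (m - 1) / k, hence largest at k = 1, where
    it equals m.\<close>
  have "cmod (?d \<alpha>) \<le> real m" for \<alpha> :: "'a \<Rightarrow> nat"
  proof (cases "mabs \<alpha> = 0")
    case False
    then have "(real m - 1) * 1 \<le> (real m - 1) * real (mabs \<alpha>)"
      using m by (intro mult_left_mono) auto
    then have "real m + real (mabs \<alpha>) - 1 \<le> real m * real (mabs \<alpha>)"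
      by (simp add: algebra_simps)
    with False m show ?thesis
      by (simp only: norm_of_real if_False) (simp add: field_simps)
  qed (use m in simp)
  from multiplier_Hm[OF f this] show ?thesis
    by (simp add: delta_def if_distrib[of "\<lambda>c. c * _"] cong: if_cong)
qed

lemma hinner_delta: "hinner m (delta m f) g = hinner m f (delta m g)"
  unfolding hinner_def delta_def by (rule infsum_cong) auto

section \<open>The row operator and its adjoints\<close>

lemma Mz_Hm: "1 \<le> m \<Longrightarrow> F \<in> Hn m \<Longrightarrow> Mz F \<in> Hm m"
  unfolding Mz_def by (rule sum_Hm) (auto simp: Hn_def Mzi_Hm)

lemma bshift_Hn: "1 \<le> m \<Longrightarrow> g \<in> Hm m \<Longrightarrow> (\<lambda>i. bshift m i g) \<in> Hn m"
  by (simp add: Hn_def bshift_Hm)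

lemma hinner_Mz:
  assumes "1 \<le> m" "F \<in> Hn m" "g \<in> Hm m"
  shows "hinner m (Mz F) g = hninner m F (\<lambda>i. bshift m i g)"
  using assms unfolding Mz_def hninner_def
  by (subst hinner_sum_left) (auto simp: Hn_def Mzi_Hm hinner_Mzi)

lemma adjHn_eqI:
  fixes C :: "'n::finite \<Rightarrow> 'n coeff"
  assumes C: "C \<in> Hn m" and adj: "\<And>F. F \<in> Hn m \<Longrightarrow> hinner m (A F) g = hninner m F C"
  shows "adjHn m A g = C"
  unfolding adjHn_def
proof (rule the_equality)
  fix D assume D: "D \<in> Hn m \<and> (\<forall>F\<in>Hn m. hinner m (A F) g = hninner m F D)"
  show "D = C"
  proof (intro ext)
    fix i :: 'n and \<beta> :: "'n \<Rightarrow> nat"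
    let ?F = "\<lambda>j. if j = i then zpow \<beta> else (\<lambda>_. 0)"
    have test: "hninner m ?F E = cnj (E i \<beta>) / complex_of_real (rho m \<beta>)" for E
    proof -
      have "hninner m ?F E = hinner m (zpow \<beta>) (E i)"
        unfolding hninner_def by (subst sum.remove[of _ i]) (auto simp: hinner_def)
      then show ?thesis by (simp add: hinner_zpow_left)
    qed
    have "?F \<in> Hn m" by (simp add: Hn_def)
    then have "hninner m ?F D = hninner m ?F C" using D adj by simp
    then show "D i \<beta> = C i \<beta>" unfolding test by simp
  qed
qed (use assms in auto)

lemma adjHn_Mz:
  assumes "1 \<le> m" "g \<in> Hm m" shows "adjHn m Mz g = (\<lambda>i. bshift m i g)"
  by (rule adjHn_eqI) (use assms in \<open>auto simp: bshift_Hn hinner_Mz\<close>)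

lemma adjHn_Mzp:
  assumes "1 \<le> m" "g \<in> Hm m" shows "adjHn m (Mzp m) g = (\<lambda>i. bshift m i (delta m g))"
  by (rule adjHn_eqI) (use assms in \<open>auto simp: bshift_Hn hinner_Mz delta_Hm Mzp_def hinner_delta\<close>)

text \<open>The i-th summand contributes \<alpha>_i / (m + |\<alpha>| - 1), and the exponents add up
  to |\<alpha>|. So \<open>Mz\<close> after its adjoint is diagonal, with exactly the eigenvalues
  that \<open>delta\<close> inverts in positive degree.\<close>

lemma Mz_bshift:
  assumes m: "1 \<le> m"
  shows "Mz (\<lambda>i. bshift m i f) \<alpha> = complex_of_real (real (mabs \<alpha>) / (real m + real (mabs \<alpha>) - 1)) * f \<alpha>"
proof -
  have "Mzi i (bshift m i f) \<alpha> = complex_of_real (real (\<alpha> i) / (real m + real (mabs \<alpha>) - 1)) * f \<alpha>" for i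
  proof (cases "1 \<le> \<alpha> i")
    case True
    then have "inc i (dec i \<alpha>) = \<alpha>" "real m + real (mabs (dec i \<alpha>)) = real m + real (mabs \<alpha>) - 1"
      using mabs_dec[of \<alpha> i] by (auto simp del: One_nat_def)
    moreover have "Suc (dec i \<alpha> i) = \<alpha> i" using True by simp
    ultimately show ?thesis using True by (simp only: Mzi_def bshift_def if_True)
  next
    case False
    then have "\<alpha> i = 0" by simp
    then show ?thesis by (simp add: Mzi_def)
  qed
  then show ?thesis
    unfolding Mz_def by (simp add: mabs_def sum_distrib_right sum_divide_distrib)
qed

lemma delta_Mz_bshift:
  fixes f :: "'n::finite coeff"
  assumes m: "1 \<le> m"
  shows "delta m (Mz (\<lambda>i. bshift m i f)) = (\<lambda>\<alpha>. if mabs \<alpha> = 0 then 0 else f \<alpha>)"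
proof
  fix \<alpha> :: "'n \<Rightarrow> nat"
  have "real m + real (mabs \<alpha>) - 1 \<noteq> 0" if "mabs \<alpha> \<noteq> 0" using that m by auto
  then have "complex_of_real (real m + real (mabs \<alpha>) - 1) \<noteq> 0" if "mabs \<alpha> \<noteq> 0"
    using that by (metis of_real_eq_0_iff)
  then show "delta m (Mz (\<lambda>i. bshift m i f)) \<alpha> = (if mabs \<alpha> = 0 then 0 else f \<alpha>)"
    by (simp add: delta_def Mz_bshift[OF m])
qed

text \<open>Diagonal operators commute, so \<open>delta\<close> may also act first. In this form
  \<open>Mz\<close> recovers f, up to its constant term, from the adjoint of \<open>Mzp m\<close> at
  f.\<close>

lemma Mz_bshift_delta:
  assumes m: "1 \<le> m"
  shows "Mz (\<lambda>i. bshift m i (delta m f)) = (\<lambda>\<alpha>. if mabs \<alpha> = 0 then 0 else f \<alpha>)"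
  unfolding delta_Mz_bshift[OF m, of f, symmetric]
  by (rule ext) (simp add: Mz_bshift[OF m] delta_def)

lemma Mz_zero_coeff: "mabs \<alpha> = 0 \<Longrightarrow> Mz F \<alpha> = 0"
  by (auto simp: Mz_def Mzi_def mabs_def)

section \<open>Orthogonal projection in \<open>Hn\<close>\<close>

lemma hnnorm_sq: "(hnnorm m F)\<^sup>2 = (\<Sum>i\<in>UNIV. (hnorm m (F i))\<^sup>2)"
  unfolding hnnorm_def by (rule real_sqrt_pow2) (auto intro: sum_nonneg)

lemma hninner_le:
  assumes "F \<in> Hn m" "G \<in> Hn m" "0 < \<epsilon>"
  shows "cmod (hninner m F G) \<le> \<epsilon> / 2 * (hnnorm m F)\<^sup>2 + 1 / (2 * \<epsilon>) * (hnnorm m G)\<^sup>2"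
proof -
  have "cmod (hninner m F G) \<le> (\<Sum>i\<in>UNIV. \<epsilon> / 2 * (hnorm m (F i))\<^sup>2 + 1 / (2 * \<epsilon>) * (hnorm m (G i))\<^sup>2)"
    unfolding hninner_def using assms by (intro sum_norm_le hinner_le) (auto simp: Hn_def)
  then show ?thesis by (simp add: hnnorm_sq sum.distrib sum_distrib_left)
qed

lemma hninner_diff_left:
  assumes "F \<in> Hn m" "G \<in> Hn m" "K \<in> Hn m"
  shows "hninner m (\<lambda>i \<alpha>. F i \<alpha> - G i \<alpha>) K = hninner m F K - hninner m G K"
  using assms by (simp add: hninner_def Hn_def hinner_diff_left sum_subtractf)

lemma hninner_diff_right:
  assumes "F \<in> Hn m" "G \<in> Hn m" "K \<in> Hn m"
  shows "hninner m K (\<lambda>i \<alpha>. F i \<alpha> - G i \<alpha>) = hninner m K F - hninner m K G"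
  using assms by (simp add: hninner_def Hn_def hinner_diff_right sum_subtractf)

lemma diff_Hn: "F \<in> Hn m \<Longrightarrow> G \<in> Hn m \<Longrightarrow> (\<lambda>i \<alpha>. F i \<alpha> - G i \<alpha>) \<in> Hn m"
  by (simp add: Hn_def diff_Hm)

lemma hninner_self_eq_0:
  assumes F: "F \<in> Hn m" and 0: "hninner m F F = 0" shows "F i \<alpha> = 0"
proof -
  have "complex_of_real (\<Sum>i\<in>UNIV. (hnorm m (F i))\<^sup>2) = 0"
    using 0 F by (simp add: hninner_def hinner_self Hn_def)
  then have "(\<Sum>i\<in>UNIV. (hnorm m (F i))\<^sup>2) = 0" by (simp only: of_real_eq_0_iff)
  then have "hnorm m (F i) = 0" by (simp add: sum_nonneg_eq_0_iff)
  then show ?thesis using F hnorm_eq_0_imp by (auto simp: Hn_def)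
qed

lemma closureHn_orthogonal:
  assumes X: "X \<in> Hn m" and V: "V \<subseteq> Hn m" and orth: "\<And>v. v \<in> V \<Longrightarrow> hninner m X v = 0"
    and Y: "Y \<in> closureHn m V"
  shows "hninner m X Y = 0"
proof (rule ccontr)
  assume neq: "hninner m X Y \<noteq> 0"
  \<comment> \<open>Calibrated so that Young's inequality bounds |<X,Y>| by half of itself: the norm
    of \<open>X\<close> and the approximation error together give \<epsilon>/2 times (norm of X
    squared, plus 1).\<close>
  define \<epsilon> where "\<epsilon> = cmod (hninner m X Y) / ((hnnorm m X)\<^sup>2 + 1)"
  have pos: "(hnnorm m X)\<^sup>2 + 1 > 0" by (simp add: add_nonneg_pos)
  then have \<epsilon>: "0 < \<epsilon>" using neq by (simp add: \<epsilon>_def)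
  then obtain v where v: "v \<in> V" "hnnorm m (\<lambda>i \<alpha>. Y i \<alpha> - v i \<alpha>) < \<epsilon>"
    using Y by (auto simp: closureHn_def)
  have Hn: "Y \<in> Hn m" "v \<in> Hn m" using Y V v by (auto simp: closureHn_def)
  let ?d = "hnnorm m (\<lambda>i \<alpha>. Y i \<alpha> - v i \<alpha>)"
  have "0 \<le> ?d" by (simp add: hnnorm_def sum_nonneg)
  then have "?d\<^sup>2 \<le> \<epsilon>\<^sup>2" using v by (intro power_mono) auto
  then have "1 / (2 * \<epsilon>) * ?d\<^sup>2 \<le> 1 / (2 * \<epsilon>) * \<epsilon>\<^sup>2" using \<epsilon> by (intro mult_left_mono) auto
  moreover have "1 / (2 * \<epsilon>) * \<epsilon>\<^sup>2 = \<epsilon> / 2" using \<epsilon> by (simp add: power2_eq_square)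
  moreover have "hninner m X Y = hninner m X (\<lambda>i \<alpha>. Y i \<alpha> - v i \<alpha>)"
    using orth[OF v(1)] by (simp add: hninner_diff_right Hn X)
  ultimately have "cmod (hninner m X Y) \<le> \<epsilon> / 2 * (hnnorm m X)\<^sup>2 + \<epsilon> / 2"
    using hninner_le[OF X diff_Hn[OF Hn] \<epsilon>] by simp
  also have "\<dots> = \<epsilon> * ((hnnorm m X)\<^sup>2 + 1) / 2" by (simp add: algebra_simps)
  also have "\<dots> = cmod (hninner m X Y) / 2" using pos by (simp add: \<epsilon>_def)
  finally show False using neq by simp
qed

lemma projHn_eqI:
  assumes V: "V \<subseteq> Hn m" and F: "F \<in> Hn m" and P: "P \<in> V"
    and orth: "\<And>v. v \<in> V \<Longrightarrow> hninner m (\<lambda>i \<alpha>. F i \<alpha> - P i \<alpha>) v = 0"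
  shows "projHn m V F = P"
  unfolding projHn_def
proof (rule the_equality)
  fix Q assume Q: "Q \<in> V \<and> (\<forall>v\<in>V. hninner m (\<lambda>i \<alpha>. F i \<alpha> - Q i \<alpha>) v = 0)"
  have Hn: "P \<in> Hn m" "Q \<in> Hn m" using V P Q by auto
  have eq: "hninner m Q v = hninner m P v" if v: "v \<in> V" for v
  proof -
    have "v \<in> Hn m" using v V by auto
    moreover have "hninner m (\<lambda>i \<alpha>. F i \<alpha> - Q i \<alpha>) v = 0" using Q v by blast
    ultimately show ?thesis using orth[OF v] F Hn by (simp add: hninner_diff_left)
  qed
  \<comment> \<open>\<open>V\<close> is only known as a set, so the second argument is expanded and
    \<open>P\<close> and \<open>Q\<close>, which lie in \<open>V\<close>, serve as test vectors
    separately.\<close>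
  have "hninner m (\<lambda>i \<alpha>. Q i \<alpha> - P i \<alpha>) (\<lambda>i \<alpha>. Q i \<alpha> - P i \<alpha>) = 0"
    using eq P Q Hn by (simp add: hninner_diff_left hninner_diff_right diff_Hn)
  from hninner_self_eq_0[OF diff_Hn[OF Hn(2,1)] this] show "Q = P"
    by (auto simp: fun_eq_iff)
qed (use P orth in auto)

text \<open>Since \<open>\<delta> M\<^sub>z M\<^sub>z\<^sup>*\<close> is the projection onto the orthogonal complement of the constants,
  the projection onto the range of \<open>M\<^sub>z\<^sup>*\<close> is \<open>M\<^sub>z\<^sup>* \<delta> M\<^sub>z\<close>.\<close>

lemma PImMzadj_eq:
  fixes F :: "'n::finite \<Rightarrow> 'n coeff"
  assumes m: "1 \<le> m" and F: "F \<in> Hn m"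
  shows "PImMzadj m F = (\<lambda>i. bshift m i (delta m (Mz F)))" (is "_ = ?P")
proof -
  define R where "R = {adjHn m Mz f |f :: 'n coeff. f \<in> Hm m}"
  have R: "R = {(\<lambda>i. bshift m i f) |f :: 'n coeff. f \<in> Hm m}"
    unfolding R_def by (auto simp: adjHn_Mz[OF m]) (use adjHn_Mz[OF m] in force)
  have d: "delta m (Mz F) \<in> Hm m" using m F by (simp add: delta_Hm Mz_Hm)
  then have P: "?P \<in> R" unfolding R by blast
  have PH: "?P \<in> Hn m" using bshift_Hn[OF m d] .
  have RH: "R \<subseteq> Hn m" unfolding R using bshift_Hn[OF m] by auto
  have "hnnorm m (\<lambda>i \<alpha>. ?P i \<alpha> - ?P i \<alpha>) = 0" by (simp add: hnnorm_def hnorm_def)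
  then have PC: "?P \<in> closureHn m R"
    using P PH unfolding closureHn_def by (intro CollectI conjI allI impI bexI[of _ ?P]) auto
  have orth: "hninner m (\<lambda>i \<alpha>. F i \<alpha> - ?P i \<alpha>) v = 0" if v: "v \<in> R" for v
  proof -
    obtain f where f: "f \<in> Hm m" "v = (\<lambda>i. bshift m i f)" using v R by auto
    \<comment> \<open>\<open>Mz ?P\<close> is \<open>Mz F\<close> without its constant term, and
      \<open>Mz F\<close> has none. So \<open>F\<close> minus the candidate is killed by
      \<open>Mz\<close>, that is, orthogonal to the range of the adjoint.\<close>
    have "Mz ?P = Mz F"
      unfolding Mz_bshift_delta[OF m] by (auto simp: Mz_zero_coeff)
    moreover have "hninner m F v = hinner m (Mz F) f" "hninner m ?P v = hinner m (Mz ?P) f"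
      using hinner_Mz[OF m F f(1)] hinner_Mz[OF m PH f(1)] f(2) by simp_all
    moreover have "hninner m (\<lambda>i \<alpha>. F i \<alpha> - ?P i \<alpha>) v = hninner m F v - hninner m ?P v"
      using hninner_diff_left[OF F PH] RH v by blast
    ultimately show ?thesis by simp
  qed
  have "projHn m (closureHn m R) F = ?P"
  proof (rule projHn_eqI[OF _ F PC])
    show "closureHn m R \<subseteq> Hn m" by (auto simp: closureHn_def)
    show "hninner m (\<lambda>i \<alpha>. F i \<alpha> - ?P i \<alpha>) v = 0" if "v \<in> closureHn m R" for v
      using closureHn_orthogonal[OF diff_Hn[OF F PH] RH orth that] .
  qed
  then show ?thesis by (simp add: PImMzadj_def R_def)
qed

section \<open>Kernel coefficients\<close>

text \<open>Multiplication by <z,w> on coefficient arrays. The guards discard negative exponents,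
  which truncated subtraction in \<open>dec\<close> would turn into spurious entries.\<close>

definition dshift :: "(('n::finite \<Rightarrow> nat) \<Rightarrow> ('n \<Rightarrow> nat) \<Rightarrow> complex) \<Rightarrow> ('n \<Rightarrow> nat) \<Rightarrow> ('n \<Rightarrow> nat) \<Rightarrow> complex" where
  "dshift y = (\<lambda>\<alpha> \<beta>. \<Sum>i\<in>UNIV. if 1 \<le> \<alpha> i \<and> 1 \<le> \<beta> i then y (dec i \<alpha>) (dec i \<beta>) else 0)"

definition ddiff :: "(('n::finite \<Rightarrow> nat) \<Rightarrow> ('n \<Rightarrow> nat) \<Rightarrow> complex) \<Rightarrow> ('n \<Rightarrow> nat) \<Rightarrow> ('n \<Rightarrow> nat) \<Rightarrow> complex" where
  "ddiff y = (\<lambda>\<alpha> \<beta>. y \<alpha> \<beta> - dshift y \<alpha> \<beta>)"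

lemma dshift_sum:
  "dshift (\<lambda>\<alpha> \<beta>. \<Sum>j\<in>J. c j * y j \<alpha> \<beta>) \<alpha> \<beta> = (\<Sum>j\<in>J. c j * dshift (y j) \<alpha> \<beta>)"
proof -
  have "dshift (\<lambda>\<alpha> \<beta>. \<Sum>j\<in>J. c j * y j \<alpha> \<beta>) \<alpha> \<beta>
    = (\<Sum>i\<in>UNIV. \<Sum>j\<in>J. c j * (if 1 \<le> \<alpha> i \<and> 1 \<le> \<beta> i then y j (dec i \<alpha>) (dec i \<beta>) else 0))"
    unfolding dshift_def by (rule sum.cong) auto
  then show ?thesis unfolding dshift_def by (subst (asm) sum.swap) (simp only: sum_distrib_left)
qed

text \<open>The binomial theorem for (1 - x)^n, with x the linear map \<open>dshift\<close>.\<close>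

lemma ddiff_funpow:
  "(ddiff ^^ n) y \<alpha> \<beta> = (\<Sum>j\<le>n. ((-1) ^ j * of_nat (n choose j)) * (dshift ^^ j) y \<alpha> \<beta>)"
proof (induction n arbitrary: \<alpha> \<beta>)
  case (Suc n)
  let ?s = "\<lambda>j. (dshift ^^ j) y \<alpha> \<beta>"
  have IH: "(ddiff ^^ n) y = (\<lambda>\<alpha> \<beta>. \<Sum>j\<le>n. ((-1) ^ j * of_nat (n choose j)) * (dshift ^^ j) y \<alpha> \<beta>)"
    using Suc by blast
  \<comment> \<open>The added term j = n + 1 is 0; with it the first sum can be shifted to match the
    second, and Pascal's rule merges them.\<close>
  have ext: "(\<Sum>j\<le>n. (-1) ^ j * of_nat (n choose j) * ?s j) = (\<Sum>j\<le>Suc n. (-1) ^ j * of_nat (n choose j) * ?s j)"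
    by (simp add: binomial_eq_0)
  have "(ddiff ^^ Suc n) y \<alpha> \<beta> = (\<Sum>j\<le>n. (-1) ^ j * of_nat (n choose j) * ?s j)
      - (\<Sum>j\<le>n. (-1) ^ j * of_nat (n choose j) * ?s (Suc j))"
    unfolding funpow.simps o_apply IH by (subst ddiff_def) (simp add: dshift_sum)
  also have "\<dots> = ?s 0 + (\<Sum>j\<le>n. (-1) ^ Suc j * of_nat (n choose Suc j) * ?s (Suc j)
      - (-1) ^ j * of_nat (n choose j) * ?s (Suc j))"
    unfolding ext sum.atMost_Suc_shift sum_subtractf by (simp del: funpow.simps)
  also have "\<dots> = ?s 0 + (\<Sum>j\<le>n. (-1) ^ Suc j * of_nat (Suc n choose Suc j) * ?s (Suc j))"
    by (intro arg_cong2[of _ _ _ _ "(+)"] sum.cong refl) (simp del: funpow.simps add: algebra_simps)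
  also have "\<dots> = (\<Sum>j\<le>Suc n. (-1) ^ j * of_nat (Suc n choose j) * ?s j)"
    unfolding sum.atMost_Suc_shift by (simp del: funpow.simps)
  finally show ?case .
qed simp

text \<open>A series with constant term 1 is not a zero divisor:
  \<open>dshift y \<alpha> \<beta>\<close> involves only entries whose first index has smaller
  degree, so \<open>y\<close> is recovered by induction on \<open>mabs \<alpha>\<close>.\<close>

lemma inj_ddiff: "inj ddiff"
proof (rule injI)
  fix y z :: "('n::finite \<Rightarrow> nat) \<Rightarrow> ('n \<Rightarrow> nat) \<Rightarrow> complex" assume eq: "ddiff y = ddiff z"
  have "y \<alpha> \<beta> = z \<alpha> \<beta>" for \<alpha> \<beta>
  proof (induction "mabs \<alpha>" arbitrary: \<alpha> \<beta> rule: less_induct)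
    case less
    have "y (dec i \<alpha>) (dec i \<beta>) = z (dec i \<alpha>) (dec i \<beta>)" if "1 \<le> \<alpha> i" for i
      using less mabs_dec[of \<alpha> i] that by auto
    then have "dshift y \<alpha> \<beta> = dshift z \<alpha> \<beta>"
      unfolding dshift_def by (intro sum.cong) auto
    with fun_cong[OF fun_cong[OF eq, of \<alpha>], of \<beta>] show ?case by (simp add: ddiff_def)
  qed
  then show "y = z" by blast
qed

text \<open>\<open>binom_weight n \<gamma>\<close> is the coefficient of \<open>z\<^sup>\<gamma> w\<^sup>\<gamma>\<close> in \<open>(1 - \<langle>z,w\<rangle>)\<^bsup>-n\<^esup>\<close>. The case \<open>n = 0\<close> is separate
  because \<open>rho 0\<close> is not the Kronecker delta (truncated subtraction).\<close>

definition binom_weight :: "nat \<Rightarrow> ('n::finite \<Rightarrow> nat) \<Rightarrow> real" where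
  "binom_weight n \<gamma> = (if n = 0 then (if \<gamma> = (\<lambda>_. 0) then 1 else 0) else rho n \<gamma>)"

lemma rho_Suc:
  assumes "1 \<le> n"
  shows "real n / (real n + real (mabs \<gamma>)) * rho (Suc n) \<gamma> = rho n \<gamma>"
proof -
  obtain k where n: "n = Suc k" using assms by (cases n) auto
  have "real (Suc k) + real (mabs \<gamma>) \<noteq> 0" by linarith
  then have "(x / (real (Suc k) + real (mabs \<gamma>))) * (((real (Suc k) + real (mabs \<gamma>)) * a) / (p * (x * q))) = a / (p * q)" if "x \<noteq> 0" for x a p q
    using that by simp
  from this[of "real (Suc k)" "fact (k + mabs \<gamma>)" "\<Prod>i\<in>UNIV. fact (\<gamma> i)" "fact k"]
  show ?thesis by (simp add: rho_def n add.commute add.left_commute)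
qed

text \<open>With x = <z,w>, this is x (1 - x)^(-n-1) = (1 - x)^(-n-1) - (1 - x)^(-n) in
  coefficients.\<close>

lemma binom_weight_dec: "(\<Sum>i\<in>UNIV. if 1 \<le> \<gamma> i then binom_weight (Suc n) (dec i \<gamma>) else 0) = binom_weight (Suc n) \<gamma> - binom_weight n \<gamma>"
proof -
  have "(\<Sum>i\<in>UNIV. if 1 \<le> \<gamma> i then binom_weight (Suc n) (dec i \<gamma>) else 0)
    = (\<Sum>i\<in>UNIV. real (\<gamma> i) / (real n + real (mabs \<gamma>)) * rho (Suc n) \<gamma>)"
  proof (rule sum.cong)
    fix i
    show "(if 1 \<le> \<gamma> i then binom_weight (Suc n) (dec i \<gamma>) else 0) = real (\<gamma> i) / (real n + real (mabs \<gamma>)) * rho (Suc n) \<gamma>"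
      using rho_dec[of "Suc n" \<gamma> i] by (auto simp: binom_weight_def split: if_splits)
  qed simp
  also have "\<dots> = real (mabs \<gamma>) / (real n + real (mabs \<gamma>)) * rho (Suc n) \<gamma>"
    by (simp add: mabs_def sum_distrib_right sum_divide_distrib)
  also have "\<dots> = binom_weight (Suc n) \<gamma> - binom_weight n \<gamma>"
  \<comment> \<open>For n = 0 the quotient is 1 off \<gamma> = 0 and, by the convention 0 / 0 = 0,
    it is 0 at \<gamma> = 0; this matches the Kronecker delta.\<close>
  proof (cases "n = 0")
    case True
    then show ?thesis using mabs_eq_0_iff[of \<gamma>] by (auto simp: binom_weight_def)
  next
    case False
    then have "real (mabs \<gamma>) / (real n + real (mabs \<gamma>)) = 1 - real n / (real n + real (mabs \<gamma>))"
      by (simp add: field_simps)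
    then show ?thesis using rho_Suc[of n \<gamma>] False by (simp add: binom_weight_def left_diff_distrib)
  qed
  finally show ?thesis .
qed

abbreviation minf :: "('n \<Rightarrow> nat) \<Rightarrow> ('n \<Rightarrow> nat) \<Rightarrow> ('n \<Rightarrow> nat)" where
  "minf \<alpha> \<beta> \<equiv> \<lambda>i. min (\<alpha> i) (\<beta> i)"

text \<open>A function \<open>d\<close> that is constant along diagonals factors out of
  \<open>dshift\<close>, so only the weight is differenced. Its argument is the minimum, the number
  of diagonal steps available in each coordinate.\<close>

lemma ddiff_binom_weight:
  assumes d: "\<And>i \<alpha> \<beta>. 1 \<le> \<alpha> i \<Longrightarrow> 1 \<le> \<beta> i \<Longrightarrow> d (dec i \<alpha>) (dec i \<beta>) = d \<alpha> \<beta>"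
  shows "ddiff (\<lambda>\<alpha> \<beta>. complex_of_real (binom_weight (Suc n) (minf \<alpha> \<beta>)) * d \<alpha> \<beta>)
    = (\<lambda>\<alpha> \<beta>. complex_of_real (binom_weight n (minf \<alpha> \<beta>)) * d \<alpha> \<beta>)"
proof (intro ext)
  fix \<alpha> \<beta>
  have "dshift (\<lambda>\<alpha> \<beta>. complex_of_real (binom_weight (Suc n) (minf \<alpha> \<beta>)) * d \<alpha> \<beta>) \<alpha> \<beta>
    = (\<Sum>i\<in>UNIV. complex_of_real (if 1 \<le> minf \<alpha> \<beta> i then binom_weight (Suc n) (dec i (minf \<alpha> \<beta>)) else 0) * d \<alpha> \<beta>)"
    unfolding dshift_def
  proof (rule sum.cong)
    fix i
    have "minf (dec i \<alpha>) (dec i \<beta>) = dec i (minf \<alpha> \<beta>)" by (rule ext) (auto simp: min_def)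
    then show "(if 1 \<le> \<alpha> i \<and> 1 \<le> \<beta> i then complex_of_real (binom_weight (Suc n) (minf (dec i \<alpha>) (dec i \<beta>))) * d (dec i \<alpha>) (dec i \<beta>) else 0)
      = complex_of_real (if 1 \<le> minf \<alpha> \<beta> i then binom_weight (Suc n) (dec i (minf \<alpha> \<beta>)) else 0) * d \<alpha> \<beta>"
      using d[of \<alpha> i \<beta>] by simp
  qed simp
  also have "\<dots> = complex_of_real (binom_weight (Suc n) (minf \<alpha> \<beta>) - binom_weight n (minf \<alpha> \<beta>)) * d \<alpha> \<beta>"
    unfolding sum_distrib_right[symmetric] of_real_sum[symmetric] binom_weight_dec ..
  finally show "ddiff (\<lambda>\<alpha> \<beta>. complex_of_real (binom_weight (Suc n) (minf \<alpha> \<beta>)) * d \<alpha> \<beta>) \<alpha> \<beta>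
      = complex_of_real (binom_weight n (minf \<alpha> \<beta>)) * d \<alpha> \<beta>"
    by (simp add: ddiff_def algebra_simps)
qed

text \<open>Both sides have the same image under the injective \<open>ddiff ^^ n\<close>. In the
  product of the boundary series with (1 - <z,w>)^(-n), the term \<gamma> reaches (\<alpha>,
  \<beta>) only from a boundary pair (\<alpha> - \<gamma>, \<beta> - \<gamma>), so \<gamma> is
  \<alpha> or \<beta>, the smaller of two comparable indices.\<close>

lemma ddiff_funpow_boundary:
  fixes y :: "('n::finite \<Rightarrow> nat) \<Rightarrow> ('n \<Rightarrow> nat) \<Rightarrow> complex"
  assumes bdry: "(ddiff ^^ n) y = (\<lambda>\<alpha> \<beta>. if \<alpha> = (\<lambda>_. 0) \<or> \<beta> = (\<lambda>_. 0) then y \<alpha> \<beta> else 0)"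
  shows "y \<alpha> \<beta> = complex_of_real (binom_weight n (minf \<alpha> \<beta>)) *
    (if (\<forall>i. \<alpha> i \<le> \<beta> i) \<or> (\<forall>i. \<beta> i \<le> \<alpha> i) then y (\<lambda>i. \<alpha> i - \<beta> i) (\<lambda>i. \<beta> i - \<alpha> i) else 0)"
proof -
  \<comment> \<open>The boundary value at the foot of the diagonal through (\<alpha>, \<beta>): for
    comparable indices one of the two truncated differences is 0.\<close>
  define d where "d = (\<lambda>\<alpha> \<beta>. if (\<forall>i. \<alpha> i \<le> \<beta> i) \<or> (\<forall>i. \<beta> i \<le> \<alpha> i) then y (\<lambda>i. \<alpha> i - \<beta> i) (\<lambda>i. \<beta> i - \<alpha> i) else 0)"
  have inv: "d (dec i \<alpha>) (dec i \<beta>) = d \<alpha> \<beta>" if "1 \<le> \<alpha> i" "1 \<le> \<beta> i" for i \<alpha> \<beta>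
  proof -
    have 1: "(\<forall>j. dec i \<alpha> j \<le> dec i \<beta> j) = (\<forall>j. \<alpha> j \<le> \<beta> j)"
            "(\<forall>j. dec i \<beta> j \<le> dec i \<alpha> j) = (\<forall>j. \<beta> j \<le> \<alpha> j)"
      using that by (auto simp: le_diff_conv2 split: if_splits)
    have 2: "(\<lambda>j. dec i \<alpha> j - dec i \<beta> j) = (\<lambda>j. \<alpha> j - \<beta> j)" "(\<lambda>j. dec i \<beta> j - dec i \<alpha> j) = (\<lambda>j. \<beta> j - \<alpha> j)"
      using that by (auto simp: fun_eq_iff)
    show ?thesis unfolding d_def 1 2 ..
  qed
  have "(ddiff ^^ k) (\<lambda>\<alpha> \<beta>. complex_of_real (binom_weight k (minf \<alpha> \<beta>)) * d \<alpha> \<beta>)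
    = (\<lambda>\<alpha> \<beta>. complex_of_real (binom_weight 0 (minf \<alpha> \<beta>)) * d \<alpha> \<beta>)" for k
    by (induction k) (simp_all add: funpow_swap1 ddiff_binom_weight[where d=d, OF inv])
  moreover have "complex_of_real (binom_weight 0 (minf \<alpha> \<beta>)) * d \<alpha> \<beta> = (if \<alpha> = (\<lambda>_. 0) \<or> \<beta> = (\<lambda>_. 0) then y \<alpha> \<beta> else 0)" for \<alpha> \<beta>
  proof (cases "\<alpha> = (\<lambda>_. 0) \<or> \<beta> = (\<lambda>_. 0)")
    case True
    then show ?thesis by (auto simp: binom_weight_def d_def)
  next
    case False
    \<comment> \<open>The weight for n = 0 survives only at minimum 0, and a comparable pair has one
      of its members as minimum; off the boundary nothing is left.\<close>
    have "\<not> ((\<forall>i. \<alpha> i \<le> \<beta> i) \<or> (\<forall>i. \<beta> i \<le> \<alpha> i))" if "minf \<alpha> \<beta> = (\<lambda>_. 0)"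
    proof
      assume "(\<forall>i. \<alpha> i \<le> \<beta> i) \<or> (\<forall>i. \<beta> i \<le> \<alpha> i)"
      then have "minf \<alpha> \<beta> = \<alpha> \<or> minf \<alpha> \<beta> = \<beta>"
        by (elim disjE) (simp_all add: min_absorb1 min_absorb2)
      with that False show False by auto
    qed
    with False show ?thesis by (auto simp: binom_weight_def d_def)
  qed
  ultimately have "(ddiff ^^ n) y = (ddiff ^^ n) (\<lambda>\<alpha> \<beta>. complex_of_real (binom_weight n (minf \<alpha> \<beta>)) * d \<alpha> \<beta>)"
    unfolding bdry by simp
  then have "y = (\<lambda>\<alpha> \<beta>. complex_of_real (binom_weight n (minf \<alpha> \<beta>)) * d \<alpha> \<beta>)"
    by (rule injD[OF inj_fn[OF inj_ddiff]])
  then have "y \<alpha> \<beta> = complex_of_real (binom_weight n (minf \<alpha> \<beta>)) * d \<alpha> \<beta>" by meson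
  then show ?thesis by (simp only: d_def)
qed

section \<open>Kernel coefficients under \<sigma> and the operator identity\<close>

definition kernel_coeff :: "nat \<Rightarrow> (('n::finite) coeff \<Rightarrow> 'n coeff) \<Rightarrow> ('n \<Rightarrow> nat) \<Rightarrow> ('n \<Rightarrow> nat) \<Rightarrow> complex" where
  "kernel_coeff m X = (\<lambda>\<alpha> \<beta>. complex_of_real (rho m \<beta>) * X (zpow \<beta>) \<alpha>)"

text \<open>At \<open>\<beta> i = 0\<close> the numerator vanishes, so it is harmless that
  \<open>dec i \<beta>\<close> is then \<open>\<beta>\<close> itself.\<close>

lemma bshift_zpow:
  "bshift m i (\<lambda>\<alpha>. c * zpow \<beta> \<alpha>)
    = (\<lambda>\<alpha>. (c * complex_of_real (real (\<beta> i) / (real m + real (mabs \<beta>) - 1))) * zpow (dec i \<beta>) \<alpha>)"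
proof
  fix \<alpha>
  show "bshift m i (\<lambda>\<alpha>. c * zpow \<beta> \<alpha>) \<alpha>
    = (c * complex_of_real (real (\<beta> i) / (real m + real (mabs \<beta>) - 1))) * zpow (dec i \<beta>) \<alpha>"
  proof (cases "inc i \<alpha> = \<beta>")
    case True
    then show ?thesis by (auto simp: bshift_def zpow_def)
  next
    case False
    have "\<beta> i = 0" if "\<alpha> = dec i \<beta>"
    proof (rule ccontr)
      assume "\<beta> i \<noteq> 0"
      then have "inc i \<alpha> = \<beta>" using that by auto
      with False show False ..
    qed
    then show ?thesis using False by (auto simp: bshift_def zpow_def)
  qed
qed

text \<open>The fragment of linearity that \<sigma> uses on monomials: their images under the
  adjoints of \<open>Mzi i\<close> are again scalar multiples of monomials. It is inherited by all
  iterates.\<close>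

definition homogeneous_op :: "(('n::finite) coeff \<Rightarrow> 'n coeff) \<Rightarrow> bool" where
  "homogeneous_op X \<longleftrightarrow> (\<forall>\<beta> c. X (\<lambda>\<alpha>. c * zpow \<beta> \<alpha>) = (\<lambda>\<alpha>. c * X (zpow \<beta>) \<alpha>))"

lemma sigmaMz_zpow:
  assumes m: "1 \<le> m" and X: "homogeneous_op X"
  shows "sigmaMz m X (\<lambda>\<alpha>. c * zpow \<beta> \<alpha>) \<alpha> = (\<Sum>i\<in>UNIV. if 1 \<le> \<alpha> i then
    c * complex_of_real (real (\<beta> i) / (real m + real (mabs \<beta>) - 1)) * X (zpow (dec i \<beta>)) (dec i \<alpha>) else 0)"
  unfolding sigmaMz_def adjH_Mzi[OF m scale_Hm[OF zpow_Hm]] bshift_zpow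
    X[unfolded homogeneous_op_def, rule_format] Mzi_def ..

lemma sigmaMz_homogeneous:
  assumes m: "1 \<le> m" and X: "homogeneous_op X" shows "homogeneous_op (sigmaMz m X)"
  unfolding homogeneous_op_def
proof (intro allI ext)
  fix \<beta> c \<alpha>
  show "sigmaMz m X (\<lambda>\<alpha>. c * zpow \<beta> \<alpha>) \<alpha> = c * sigmaMz m X (zpow \<beta>) \<alpha>"
    using sigmaMz_zpow[OF m X, of 1 \<beta> \<alpha>]
    by (simp add: sigmaMz_zpow[OF m X] sum_distrib_left if_distrib[of "\<lambda>x. c * x"] mult.assoc cong: if_cong)
qed

text \<open>\<open>rho_dec\<close> turns the adjoint's coefficient times \<rho>(\<beta>) into
  \<rho>(\<beta> - e_i), the normalization of the lowered entry, or into 0 when the entry is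
  absent.\<close>

lemma kernel_coeff_sigmaMz:
  assumes m: "1 \<le> m" and X: "homogeneous_op X"
  shows "kernel_coeff m (sigmaMz m X) = dshift (kernel_coeff m X)"
proof (intro ext)
  fix \<alpha> \<beta>
  have "kernel_coeff m (sigmaMz m X) \<alpha> \<beta> = (\<Sum>i\<in>UNIV. if 1 \<le> \<alpha> i then
    complex_of_real (real (\<beta> i) / (real m + real (mabs \<beta>) - 1) * rho m \<beta>) * X (zpow (dec i \<beta>)) (dec i \<alpha>) else 0)"
    using sigmaMz_zpow[OF m X, of 1 \<beta> \<alpha>]
    by (simp add: kernel_coeff_def sum_distrib_left if_distrib[of "\<lambda>x. _ * x"] mult_ac cong: if_cong)
  also have "\<dots> = dshift (kernel_coeff m X) \<alpha> \<beta>"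
    unfolding rho_dec[OF m, symmetric] dshift_def kernel_coeff_def by (rule sum.cong) auto
  finally show "kernel_coeff m (sigmaMz m X) \<alpha> \<beta> = dshift (kernel_coeff m X) \<alpha> \<beta>" .
qed

lemma sigmaMz_Hm:
  assumes m: "1 \<le> m" and X: "\<And>f. f \<in> Hm m \<Longrightarrow> X f \<in> Hm m" and f: "f \<in> Hm m"
  shows "sigmaMz m X f \<in> Hm m"
  unfolding sigmaMz_def
  by (intro sum_Hm) (auto simp: adjH_Mzi[OF m f] intro!: Mzi_Hm[OF m] X bshift_Hm[OF m f])

lemma sigmaMz_funpow:
  assumes m: "1 \<le> m" and T: "\<And>f. f \<in> Hm m \<Longrightarrow> T f \<in> Hm m" "homogeneous_op T"
  shows "(\<forall>f\<in>Hm m. (sigmaMz m ^^ j) T f \<in> Hm m) \<and> homogeneous_op ((sigmaMz m ^^ j) T)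
    \<and> kernel_coeff m ((sigmaMz m ^^ j) T) = (dshift ^^ j) (kernel_coeff m T)"
proof (induction j)
  case (Suc j)
  then show ?case
    by (simp add: sigmaMz_Hm[OF m] sigmaMz_homogeneous[OF m] kernel_coeff_sigmaMz[OF m])
qed (use T in auto)

text \<open>The operator identity enters only through its values on \<open>M\<^sub>z\<^sup>* z\<^sup>\<beta>\<close>; applying \<open>M\<^sub>z\<close>
  turns it into \<open>Q T Q = \<sigma>(S)\<close> with \<open>Q\<close> the projection onto the complement of the constants.\<close>

lemma kernel_coeff_boundary:
  fixes T :: "('n::finite) coeff \<Rightarrow> 'n coeff"
  assumes m: "1 \<le> m" and T: "\<And>f. f \<in> Hm m \<Longrightarrow> T f \<in> Hm m" "homogeneous_op T"
    and hyp: "\<forall>F\<in>Hn m. adjHn m (Mzp m) (T (Mzp m F))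
             = PImMzadj m (oplus_op (Sop m T) (PImMzadj m F))"
  shows "(ddiff ^^ m) (kernel_coeff m T)
    = (\<lambda>\<alpha> \<beta>. if \<alpha> = (\<lambda>_. 0) \<or> \<beta> = (\<lambda>_. 0) then kernel_coeff m T \<alpha> \<beta> else 0)"
proof (intro ext)
  fix \<alpha> \<beta> :: "'n \<Rightarrow> nat"
  let ?y = "kernel_coeff m T"
  \<comment> \<open>The coefficient of \<sigma>(S) for S = \<open>Sop m T\<close>: the terms of
    positive degree in (1 - \<sigma>)^m, with sign reversed and the index lowered by one.\<close>
  let ?R = "\<Sum>j<m. ((-1) ^ j * of_nat (m choose (j + 1))) * (dshift ^^ Suc j) ?y \<alpha> \<beta>"
  have "(ddiff ^^ m) ?y \<alpha> \<beta> = (\<Sum>j<Suc m. ((-1) ^ j * of_nat (m choose j)) * (dshift ^^ j) ?y \<alpha> \<beta>)"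
    unfolding ddiff_funpow lessThan_Suc_atMost ..
  also have "\<dots> = ?y \<alpha> \<beta> - ?R"
    unfolding sum.lessThan_Suc_shift by (simp del: funpow.simps add: sum_negf)
  finally have L: "(ddiff ^^ m) ?y \<alpha> \<beta> = ?y \<alpha> \<beta> - ?R" .
  show "(ddiff ^^ m) ?y \<alpha> \<beta> = (if \<alpha> = (\<lambda>_. 0) \<or> \<beta> = (\<lambda>_. 0) then ?y \<alpha> \<beta> else 0)"
  proof (cases "\<alpha> = (\<lambda>_. 0) \<or> \<beta> = (\<lambda>_. 0)")
    case True
    then have "dshift x \<alpha> \<beta> = 0" for x by (auto simp: dshift_def)
    then have "?R = 0" by simp
    with L True show ?thesis by simp
  next
    case False
    then have ne: "mabs \<alpha> \<noteq> 0" "mabs \<beta> \<noteq> 0" by (simp_all add: mabs_eq_0_iff)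
    note sT = sigmaMz_funpow[OF m T]
    \<comment> \<open>For nonconstant z^\<beta> this vector satisfies
      \<open>Mzp m F = zpow \<beta>\<close> and is fixed by the projection, so the hypothesis speaks
      directly about T z^\<beta>.\<close>
    define F where "F = (\<lambda>i. bshift m i (zpow \<beta>))"
    have F: "F \<in> Hn m" unfolding F_def by (rule bshift_Hn[OF m zpow_Hm])
    have dF: "delta m (Mz F) = zpow \<beta>"
      unfolding F_def delta_Mz_bshift[OF m] using ne by (auto simp: zpow_def)
    have PF: "PImMzadj m F = F"
      unfolding PImMzadj_eq[OF m F] dF by (simp add: F_def)
    define G where "G = (\<lambda>i. Sop m T (F i))"
    have G: "G \<in> Hn m"
      unfolding G_def Sop_def Hn_def using F sT
      by (auto simp: Hn_def intro!: sum_Hm scale_Hm)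
    have "(\<lambda>i. bshift m i (delta m (T (zpow \<beta>)))) = (\<lambda>i. bshift m i (delta m (Mz G)))"
      using hyp[rule_format, OF F]
      by (simp add: adjHn_Mzp[OF m] T Mzp_def dF PF oplus_op_def G_def[symmetric] PImMzadj_eq[OF m G])
    \<comment> \<open>Both sides are the adjoint of \<open>Mzp m\<close> at some X, and
      \<open>Mz\<close> maps this back to X off the constants; here the row \<alpha> = 0 is
      lost.\<close>
    then have "Mz (\<lambda>i. bshift m i (delta m (T (zpow \<beta>)))) = Mz (\<lambda>i. bshift m i (delta m (Mz G)))"
      by (rule arg_cong)
    from fun_cong[OF this, of \<alpha>] have "T (zpow \<beta>) \<alpha> = Mz G \<alpha>"
      using ne by (simp add: Mz_bshift_delta[OF m])
    also have "\<dots> = (\<Sum>i\<in>UNIV. \<Sum>j<m. ((-1) ^ j * of_nat (m choose (j + 1))) * Mzi i ((sigmaMz m ^^ j) T (F i)) \<alpha>)"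
      unfolding Mz_def G_def Sop_def Mzi_def by (rule sum.cong) auto
    also have "\<dots> = (\<Sum>j<m. ((-1) ^ j * of_nat (m choose (j + 1))) * (sigmaMz m ^^ Suc j) T (zpow \<beta>) \<alpha>)"
      by (subst sum.swap) (simp add: sum_distrib_left sigmaMz_def adjH_Mzi[OF m zpow_Hm] F_def)
    finally have "?y \<alpha> \<beta> = (\<Sum>j<m. ((-1) ^ j * of_nat (m choose (j + 1))) * kernel_coeff m ((sigmaMz m ^^ Suc j) T) \<alpha> \<beta>)"
      unfolding kernel_coeff_def by (simp add: sum_distrib_left mult_ac)
    also have "\<dots> = ?R" using sT by (simp only:)
    finally show ?thesis using L False by simp
  qed
qed

section \<open>Toeplitz operators and the symbol\<close>

lemma finite_below: "finite {\<beta>::'n::finite \<Rightarrow> nat. \<forall>i. \<beta> i \<le> \<alpha> i}"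
proof -
  have "{\<beta>. \<forall>i. \<beta> i \<le> \<alpha> i} = PiE UNIV (\<lambda>i. {..\<alpha> i})" by (auto simp: PiE_def Pi_def)
  then show ?thesis by (simp add: finite_PiE)
qed

lemma cmult_reflect: "cmult u v \<alpha> = (\<Sum>\<beta>\<in>{\<beta>. \<forall>i. \<beta> i \<le> \<alpha> i}. u (\<lambda>i. \<alpha> i - \<beta> i) * v \<beta>)"
  unfolding cmult_def
  by (rule sum.reindex_bij_witness[where i="\<lambda>\<beta> i. \<alpha> i - \<beta> i" and j="\<lambda>\<beta> i. \<alpha> i - \<beta> i"]) auto

lemma cmult_finite:
  assumes "finite S" "\<And>\<beta>. \<beta> \<notin> S \<Longrightarrow> v \<beta> = 0"
  shows "cmult u v \<alpha> = (\<Sum>\<beta>\<in>S. if \<forall>i. \<beta> i \<le> \<alpha> i then u (\<lambda>i. \<alpha> i - \<beta> i) * v \<beta> else 0)"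
proof -
  have "cmult u v \<alpha> = (\<Sum>\<beta>\<in>S \<inter> {\<beta>. \<forall>i. \<beta> i \<le> \<alpha> i}. u (\<lambda>i. \<alpha> i - \<beta> i) * v \<beta>)"
    unfolding cmult_reflect by (rule sum.mono_neutral_right[OF finite_below]) (use assms in auto)
  then show ?thesis by (simp add: sum.inter_restrict[OF assms(1)])
qed

lemma cmult_zpow: "cmult u (zpow \<alpha>) = (\<lambda>\<gamma>. if \<forall>i. \<alpha> i \<le> \<gamma> i then u (\<lambda>i. \<gamma> i - \<alpha> i) else 0)"
  by (rule ext, subst cmult_finite[of "{\<alpha>}"]) (auto simp: zpow_def)

lemma zpow_domT: "1 \<le> m \<Longrightarrow> u \<in> Hm m \<Longrightarrow> zpow \<alpha> \<in> domT m u"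
  by (simp add: domT_def cmult_zpow shift_Hm)

text \<open>All terms live on the finite set of exponents below the support of \<open>p\<close>, so
  the two sums in the adjoint identity can be interchanged.\<close>

lemma Tadj_poly:
  fixes h :: "'n::finite coeff"
  assumes m: "1 \<le> m" and h: "h \<in> Hm m" and S: "finite S" "\<And>\<beta>. \<beta> \<notin> S \<Longrightarrow> p \<beta> = 0"
  shows "Tadj m h p = (\<lambda>\<alpha>. \<Sum>\<beta>\<in>S. if \<forall>i. \<alpha> i \<le> \<beta> i
    then p \<beta> * complex_of_real (rho m \<alpha> / rho m \<beta>) * cnj (h (\<lambda>i. \<beta> i - \<alpha> i)) else 0)" (is "_ = ?c")
proof -
  define D where "D = (\<Union>\<beta>\<in>S. {\<alpha>. \<forall>i. \<alpha> i \<le> \<beta> i})"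
  have D: "finite D" unfolding D_def using S(1) finite_below by blast
  have c0: "?c \<alpha> = 0" if "\<alpha> \<notin> D" for \<alpha>
    by (rule sum.neutral) (use that in \<open>auto simp: D_def\<close>)
  have cH: "?c \<in> Hm m"
    by (rule Hm_finite_support, rule finite_subset[OF _ D]) (use c0 in blast)
  have adj: "hinner m (cmult h v) p = hinner m v ?c" for v
  proof -
    have "hinner m v ?c = (\<Sum>\<alpha>\<in>D. v \<alpha> * cnj (?c \<alpha>) / complex_of_real (rho m \<alpha>))"
      by (rule hinner_finite[OF D]) (use c0 in blast)
    also have "\<dots> = (\<Sum>\<alpha>\<in>D. \<Sum>\<beta>\<in>S. if \<forall>i. \<alpha> i \<le> \<beta> i
        then h (\<lambda>i. \<beta> i - \<alpha> i) * v \<alpha> * cnj (p \<beta>) / complex_of_real (rho m \<beta>) else 0)"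
      unfolding cnj_sum sum_distrib_left sum_divide_distrib
      by (intro sum.cong refl) (auto simp: mult_ac)
    also have "\<dots> = (\<Sum>\<beta>\<in>S. \<Sum>\<alpha>\<in>D. if \<forall>i. \<alpha> i \<le> \<beta> i
        then h (\<lambda>i. \<beta> i - \<alpha> i) * v \<alpha> * cnj (p \<beta>) / complex_of_real (rho m \<beta>) else 0)"
      by (rule sum.swap)
    also have "\<dots> = (\<Sum>\<beta>\<in>S. cmult h v \<beta> * cnj (p \<beta>) / complex_of_real (rho m \<beta>))"
    proof (rule sum.cong[OF refl])
      fix \<beta> assume \<beta>: "\<beta> \<in> S"
      have "(\<Sum>\<alpha>\<in>D. if \<forall>i. \<alpha> i \<le> \<beta> i then h (\<lambda>i. \<beta> i - \<alpha> i) * v \<alpha> * cnj (p \<beta>) / complex_of_real (rho m \<beta>) else 0)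
        = (\<Sum>\<alpha>\<in>D \<inter> {\<alpha>. \<forall>i. \<alpha> i \<le> \<beta> i}. h (\<lambda>i. \<beta> i - \<alpha> i) * v \<alpha> * cnj (p \<beta>) / complex_of_real (rho m \<beta>))"
        by (simp add: sum.inter_restrict[OF D])
      also have "D \<inter> {\<alpha>. \<forall>i. \<alpha> i \<le> \<beta> i} = {\<alpha>. \<forall>i. \<alpha> i \<le> \<beta> i}" using \<beta> by (auto simp: D_def)
      finally show "(\<Sum>\<alpha>\<in>D. if \<forall>i. \<alpha> i \<le> \<beta> i then h (\<lambda>i. \<beta> i - \<alpha> i) * v \<alpha> * cnj (p \<beta>) / complex_of_real (rho m \<beta>) else 0)
        = cmult h v \<beta> * cnj (p \<beta>) / complex_of_real (rho m \<beta>)"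
        by (simp add: cmult_reflect sum_distrib_right sum_divide_distrib)
    qed
    also have "\<dots> = hinner m (cmult h v) p"
      by (rule hinner_finite[OF S(1), symmetric]) (use S(2) in blast)
    finally show ?thesis by simp
  qed
  show ?thesis unfolding Tadj_def
  proof (rule the_equality)
    fix d assume d: "d \<in> Hm m \<and> (\<forall>v\<in>domT m h. hinner m (cmult h v) p = hinner m v d)"
    show "d = ?c"
    proof
      fix \<alpha>
      \<comment> \<open>Monomials lie in the domain of T_h because h is in \<open>Hm m\<close>, and
        they determine every coefficient.\<close>
      have "hinner m (zpow \<alpha>) d = hinner m (zpow \<alpha>) ?c"
        using d zpow_domT[OF m h] adj by metis
      then show "d \<alpha> = ?c \<alpha>"
        by (simp only: hinner_zpow_left divide_cancel_right complex_cnj_cancel_iff of_real_eq_0_iff rho_neq_0 simp_thms)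
    qed
  qed (use cH adj in simp)
qed

section \<open>The rotation average at the constant function\<close>

lemma integral_exp_nat:
  "integral {0..2*pi} (\<lambda>t. exp (\<i> * complex_of_real (t * real k))) = (if k = 0 then complex_of_real (2*pi) else 0)"
proof (cases "k = 0")
  case False
  have "((\<lambda>t. exp (\<i> * complex_of_real (t * real k))) has_integral
      (exp (\<i> * complex_of_real (2 * pi * real k)) / (\<i> * of_nat k) - exp (\<i> * complex_of_real (0 * real k)) / (\<i> * of_nat k))) {0..2*pi}"
  proof (rule fundamental_theorem_of_calculus)
    fix x :: real
    have "((\<lambda>z. exp (\<i> * z * of_nat k) / (\<i> * of_nat k)) has_field_derivative exp (\<i> * of_real x * of_nat k)) (at (of_real x))"
      using False by (auto intro!: derivative_eq_intros)
    from has_vector_derivative_real_field[OF this]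
    show "((\<lambda>t. exp (\<i> * complex_of_real (t * real k)) / (\<i> * of_nat k)) has_vector_derivative exp (\<i> * complex_of_real (x * real k))) (at x within {0..2*pi})"
      by (simp add: mult_ac)
  qed simp
  moreover have "exp (\<i> * complex_of_real (2 * pi * real k)) = 1"
    unfolding exp_eq_1 by (auto intro!: exI[of _ "int k"])
  ultimately show ?thesis using False by (auto dest: integral_unique)
qed (simp add: scaleR_conv_of_real)

text \<open>Only the degree 0 term survives the average. The terms are bounded, uniformly in t, by a
  summable family, so the M-test lets the integral pass through the unordered sum.\<close>

lemma integral_Ut:
  fixes y g :: "'n::finite coeff"
  assumes y: "y \<in> Hm m" and g: "g \<in> Hm m"
  shows "integral {0..2*pi} (\<lambda>t. hinner m (Ut t y) g) = complex_of_real (2*pi) * (y (\<lambda>_. 0) * cnj (g (\<lambda>_. 0)))"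
proof -
  define a where "a = (\<lambda>\<alpha>. y \<alpha> * cnj (g \<alpha>) / complex_of_real (rho m \<alpha>))"
  define f where "f = (\<lambda>(\<alpha>::'n \<Rightarrow> nat) t. exp (\<i> * complex_of_real (t * real (mabs \<alpha>))) * a \<alpha>)"
  have hf: "hinner m (Ut t y) g = (\<Sum>\<^sub>\<infinity>\<alpha>. f \<alpha> t)" for t
    unfolding hinner_def Ut_def f_def a_def by (rule infsum_cong) simp
  have "uniform_limit (cbox 0 (2*pi)) (\<lambda>F t. \<Sum>\<alpha>\<in>F. f \<alpha> t) (\<lambda>t. \<Sum>\<^sub>\<infinity>\<alpha>. f \<alpha> t) (finite_subsets_at_top UNIV)"
  proof (rule Weierstrass_m_test_general)
    show "norm (f \<alpha> t) \<le> cmod (a \<alpha>)" for \<alpha> t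
      unfolding f_def norm_mult norm_exp_i_times by simp
    show "(\<lambda>\<alpha>. cmod (a \<alpha>)) summable_on UNIV"
      unfolding a_def by (rule inner_abs_summable[OF y g])
  qed
  then obtain I J where I: "\<And>F. ((\<lambda>t. \<Sum>\<alpha>\<in>F. f \<alpha> t) has_integral I F) (cbox 0 (2*pi))"
    and J: "((\<lambda>t. \<Sum>\<^sub>\<infinity>\<alpha>. f \<alpha> t) has_integral J) (cbox 0 (2*pi))"
    and lim: "(I \<longlongrightarrow> J) (finite_subsets_at_top UNIV)"
    by (rule uniform_limit_integral_cbox) (auto simp: f_def intro!: continuous_intros)
  have int: "f \<alpha> integrable_on {0..2*pi}" for \<alpha>
    unfolding f_def by (intro integrable_continuous_real continuous_intros)
  have If: "integral {0..2*pi} (f \<alpha>) = (if \<alpha> = (\<lambda>_. 0) then complex_of_real (2*pi) * a \<alpha> else 0)" for \<alpha>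
    unfolding f_def using integral_exp_nat[of "mabs \<alpha>"] mabs_eq_0_iff[of \<alpha>] by auto
  \<comment> \<open>Once \<open>F\<close> contains the zero exponent the integral no longer changes,
    so its limit is that of an eventually constant net.\<close>
  have "I F = complex_of_real (2*pi) * a (\<lambda>_. 0)" if "finite F" "(\<lambda>_. 0) \<in> F" for F
  proof -
    have "I F = integral {0..2*pi} (\<lambda>t. \<Sum>\<alpha>\<in>F. f \<alpha> t)"
      using I[of F] by (simp add: integral_unique)
    also have "\<dots> = (\<Sum>\<alpha>\<in>F. integral {0..2*pi} (f \<alpha>))"
      using that int by (intro integral_sum) auto
    also have "\<dots> = complex_of_real (2*pi) * a (\<lambda>_. 0)"
      unfolding If using that by (simp add: sum.delta)
    finally show ?thesis .
  qed
  then have "eventually (\<lambda>F. I F = complex_of_real (2*pi) * a (\<lambda>_. 0)) (finite_subsets_at_top UNIV)"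
    unfolding eventually_finite_subsets_at_top by (intro exI[of _ "{\<lambda>_. 0}"]) auto
  then have "(I \<longlongrightarrow> complex_of_real (2*pi) * a (\<lambda>_. 0)) (finite_subsets_at_top UNIV)"
    by (rule tendsto_eventually)
  then have "J = complex_of_real (2*pi) * a (\<lambda>_. 0)"
    using lim by (intro tendsto_unique[OF finite_subsets_at_top_neq_bot])
  moreover have "integral {0..2*pi} (\<lambda>t. hinner m (Ut t y) g) = J"
    unfolding hf using J by (simp add: integral_unique)
  ultimately show ?thesis by (simp add: a_def)
qed

lemma adjH_Ut_one: "adjH m (Ut t) one = one"
  unfolding one_eq_zpow
  by (rule adjH_eqI) (auto simp: hinner_zpow_right Ut_def mabs_def)

text \<open>The adjoint of U(t) fixes 1, so T_0 1 is the rotation average of T 1.\<close>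

lemma T0_one:
  assumes y: "T one \<in> Hm m"
  shows "T0 m T one = (\<lambda>\<alpha>. T one (\<lambda>_. 0) * one \<alpha>)"
  unfolding T0_def adjH_Ut_one
proof (rule the_equality)
  have int: "integral {0..2*pi} (\<lambda>t. hinner m (Ut t (T one)) g) / complex_of_real (2*pi) = T one (\<lambda>_. 0) * cnj (g (\<lambda>_. 0))"
    if "g \<in> Hm m" for g
    unfolding integral_Ut[OF y that] by simp
  have c: "(\<lambda>\<alpha>. T one (\<lambda>_. 0) * one \<alpha>) \<in> Hm m"
    unfolding one_eq_zpow by (rule scale_Hm) simp
  then show "(\<lambda>\<alpha>. T one (\<lambda>_. 0) * one \<alpha>) \<in> Hm m \<and> (\<forall>g\<in>Hm m. hinner m (\<lambda>\<alpha>. T one (\<lambda>_. 0) * one \<alpha>) g =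
      integral {0..2*pi} (\<lambda>t. hinner m (Ut t (T one)) g) / complex_of_real (2*pi))"
    using int by (simp add: hinner_scale_left hinner_zpow_left one_eq_zpow)
  fix z assume z: "z \<in> Hm m \<and> (\<forall>g\<in>Hm m. hinner m z g =
      integral {0..2*pi} (\<lambda>t. hinner m (Ut t (T one)) g) / complex_of_real (2*pi))"
  show "z = (\<lambda>\<alpha>. T one (\<lambda>_. 0) * one \<alpha>)"
    by (rule Hm_eqI_hinner[of m]) (use z int in \<open>simp add: hinner_scale_left hinner_zpow_left one_eq_zpow\<close>)
qed

section \<open>Bounded operators on monomials and the adjoint at 1\<close>

lemma bop_linear:
  assumes "bop m T" "f \<in> Hm m" "g \<in> Hm m"
  shows "T (\<lambda>\<alpha>. f \<alpha> + c * g \<alpha>) = (\<lambda>\<alpha>. T f \<alpha> + c * T g \<alpha>)"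
  using assms unfolding bop_def by simp

lemma bop_diff:
  assumes T: "bop m T" and "f \<in> Hm m" "g \<in> Hm m"
  shows "T (\<lambda>\<alpha>. f \<alpha> - g \<alpha>) = (\<lambda>\<alpha>. T f \<alpha> - T g \<alpha>)"
  using bop_linear[OF assms, of "-1"] by simp

lemma bop_zero: "bop m T \<Longrightarrow> T (\<lambda>_. 0) = (\<lambda>_. 0)"
  using bop_diff[of m T "\<lambda>_. 0" "\<lambda>_. 0"] by simp

lemma bop_scale:
  assumes T: "bop m T" and "f \<in> Hm m"
  shows "T (\<lambda>\<alpha>. c * f \<alpha>) = (\<lambda>\<alpha>. c * T f \<alpha>)"
  using bop_linear[OF T zero_Hm assms(2), of c] by (simp add: bop_zero[OF T])

lemma bop_sum:
  assumes T: "bop m T" and S: "finite S"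
  shows "T (\<lambda>\<alpha>. \<Sum>\<beta>\<in>S. p \<beta> * zpow \<beta> \<alpha>) = (\<lambda>\<alpha>. \<Sum>\<beta>\<in>S. p \<beta> * T (zpow \<beta>) \<alpha>)"
  using S
proof (induction S rule: finite_induct)
  case empty
  show ?case by (simp add: bop_zero[OF T])
next
  case (insert \<beta> S)
  have H: "(\<lambda>\<alpha>. \<Sum>\<beta>\<in>S. p \<beta> * zpow \<beta> \<alpha>) \<in> Hm m"
    by (rule sum_Hm[OF insert(1)]) (simp add: scale_Hm)
  have eq: "(\<lambda>\<alpha>. \<Sum>\<gamma>\<in>insert \<beta> S. p \<gamma> * zpow \<gamma> \<alpha>) = (\<lambda>\<alpha>. (\<Sum>\<gamma>\<in>S. p \<gamma> * zpow \<gamma> \<alpha>) + p \<beta> * zpow \<beta> \<alpha>)"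
    by (rule ext) (use insert(1,2) in \<open>simp add: add.commute\<close>)
  show ?case
    unfolding eq bop_linear[OF T H zpow_Hm] insert.IH
    by (rule ext) (use insert(1,2) in \<open>simp add: add.commute\<close>)
qed

lemma finite_support_expand:
  assumes "finite S"
  shows "(\<Sum>\<beta>\<in>S. p \<beta> * zpow \<beta> \<alpha>) = (if \<alpha> \<in> S then p \<alpha> else 0)"
  using assms by (simp add: zpow_def if_distrib[of "\<lambda>x. _ * x"] sum.delta cong: if_cong)

lemma hnorm_sq_restrict:
  assumes f: "f \<in> Hm m" and S: "finite S"
  shows "(hnorm m (\<lambda>\<alpha>. f \<alpha> - (if \<alpha> \<in> S then f \<alpha> else 0)))\<^sup>2 = (hnorm m f)\<^sup>2 - (\<Sum>\<alpha>\<in>S. (cmod (f \<alpha>))\<^sup>2 / rho m \<alpha>)"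
proof -
  have "(hnorm m (\<lambda>\<alpha>. f \<alpha> - (if \<alpha> \<in> S then f \<alpha> else 0)))\<^sup>2 = (\<Sum>\<^sub>\<infinity>\<alpha>\<in>UNIV - S. (cmod (f \<alpha>))\<^sup>2 / rho m \<alpha>)"
    unfolding hnorm_sq by (rule infsum_cong_neutral) auto
  also have "\<dots> = (hnorm m f)\<^sup>2 - (\<Sum>\<^sub>\<infinity>\<alpha>\<in>S. (cmod (f \<alpha>))\<^sup>2 / rho m \<alpha>)"
    unfolding hnorm_sq using f S by (intro infsum_Diff) (auto simp: Hm_def)
  finally show ?thesis using S by simp
qed

lemma bop_coeff_bound:
  assumes T: "bop m T"
  shows "\<exists>C. \<forall>f\<in>Hm m. (cmod (T f (\<lambda>_. 0)))\<^sup>2 \<le> C\<^sup>2 * (hnorm m f)\<^sup>2"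
proof -
  obtain C where C: "\<And>f. f \<in> Hm m \<Longrightarrow> hnorm m (T f) \<le> C * hnorm m f" using T unfolding bop_def by blast
  have "(cmod (T f (\<lambda>_. 0)))\<^sup>2 \<le> C\<^sup>2 * (hnorm m f)\<^sup>2" if f: "f \<in> Hm m" for f
  proof -
    have "T f \<in> Hm m" using T f unfolding bop_def by blast
    from hnorm_coeff_le[OF this, of "\<lambda>_. 0"] have "(cmod (T f (\<lambda>_. 0)))\<^sup>2 \<le> (hnorm m (T f))\<^sup>2" by simp
    also have "\<dots> \<le> (C * hnorm m f)\<^sup>2" using C[OF f] by (intro power_mono) auto
    finally show ?thesis by (simp add: power_mult_distrib)
  qed
  then show ?thesis by blast
qed

text \<open>Riesz representation of the functional \<open>f \<mapsto> (T f)(0)\<close>, tested on the truncations of its representing vector.\<close>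

lemma adjH_one:
  fixes T :: "'n::finite coeff \<Rightarrow> 'n coeff"
  assumes T: "bop m T"
  defines "h \<equiv> \<lambda>\<beta>. complex_of_real (rho m \<beta>) * cnj (T (zpow \<beta>) (\<lambda>_. 0))"
  shows "h \<in> Hm m" "adjH m T one = h"
proof -
  obtain C where C: "\<And>f. f \<in> Hm m \<Longrightarrow> (cmod (T f (\<lambda>_. 0)))\<^sup>2 \<le> C\<^sup>2 * (hnorm m f)\<^sup>2"
    using bop_coeff_bound[OF T] by blast
  have trunc: "(\<lambda>\<alpha>. if \<alpha> \<in> S then f \<alpha> else 0) \<in> Hm m"
    "T (\<lambda>\<alpha>. if \<alpha> \<in> S then f \<alpha> else 0) (\<lambda>_. 0) = (\<Sum>\<beta>\<in>S. f \<beta> * T (zpow \<beta>) (\<lambda>_. 0))"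
    if "finite S" for S f
  proof -
    show "(\<lambda>\<alpha>. if \<alpha> \<in> S then f \<alpha> else 0) \<in> Hm m"
      by (rule Hm_finite_support, rule finite_subset[OF _ that]) auto
    show "T (\<lambda>\<alpha>. if \<alpha> \<in> S then f \<alpha> else 0) (\<lambda>_. 0) = (\<Sum>\<beta>\<in>S. f \<beta> * T (zpow \<beta>) (\<lambda>_. 0))"
      using bop_sum[OF T that, of f] by (simp add: finite_support_expand[OF that])
  qed
  \<comment> \<open>For the truncation f of \<open>h\<close> to \<open>S\<close>, both (T f)_0 and
    the squared norm of f equal the partial sum s, so s^2 \<le> C^2 s. Cancelling s gives a bound
    independent of \<open>S\<close>.\<close>
  have bound: "(\<Sum>\<beta>\<in>S. (cmod (h \<beta>))\<^sup>2 / rho m \<beta>) \<le> C\<^sup>2" if S: "finite S" for S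
  proof -
    let ?s = "\<Sum>\<beta>\<in>S. (cmod (h \<beta>))\<^sup>2 / rho m \<beta>"
    let ?f = "\<lambda>\<alpha>. if \<alpha> \<in> S then h \<alpha> else 0"
    have "(hnorm m ?f)\<^sup>2 = (\<Sum>\<^sub>\<infinity>\<beta>\<in>S. (cmod (h \<beta>))\<^sup>2 / rho m \<beta>)"
      unfolding hnorm_sq by (rule infsum_cong_neutral) auto
    then have nf: "(hnorm m ?f)\<^sup>2 = ?s" using S by simp
    have "T ?f (\<lambda>_. 0) = complex_of_real ?s"
      unfolding trunc(2)[OF S] of_real_sum
    proof (rule sum.cong[OF refl])
      fix \<beta>
      have "T (zpow \<beta>) (\<lambda>_. 0) = cnj (h \<beta>) / complex_of_real (rho m \<beta>)" by (simp add: h_def)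
      then show "h \<beta> * T (zpow \<beta>) (\<lambda>_. 0) = complex_of_real ((cmod (h \<beta>))\<^sup>2 / rho m \<beta>)"
        by (simp del: of_real_power add: of_real_divide complex_norm_square)
    qed
    then have "?s\<^sup>2 \<le> C\<^sup>2 * ?s"
      using C[OF trunc(1)[OF S, of h]] by (simp only: nf norm_of_real power2_abs)
    then have le: "?s * ?s \<le> C\<^sup>2 * ?s" by (simp only: power2_eq_square)
    show ?thesis
    proof (cases "0 < ?s")
      case True
      with le show ?thesis by (rule mult_right_le_imp_le)
    next
      case False
      then show ?thesis using zero_le_power2[of C] by linarith
    qed
  qed
  show hH: "h \<in> Hm m"
    unfolding Hm_def mem_Collect_eq
    by (rule nonneg_bdd_above_summable_on) (auto intro!: bdd_aboveI2[where M="C\<^sup>2"] bound)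
  show "adjH m T one = h"
  proof (rule adjH_eqI[OF hH])
    fix f :: "'n coeff" assume f: "f \<in> Hm m"
    let ?F = "finite_subsets_at_top (UNIV :: ('n \<Rightarrow> nat) set)"
    have sq: "((\<lambda>S. C\<^sup>2 * ((hnorm m f)\<^sup>2 - (\<Sum>\<alpha>\<in>S. (cmod (f \<alpha>))\<^sup>2 / rho m \<alpha>))) \<longlongrightarrow> C\<^sup>2 * ((hnorm m f)\<^sup>2 - (hnorm m f)\<^sup>2)) ?F"
    proof (intro tendsto_intros)
      have "((\<lambda>\<alpha>. (cmod (f \<alpha>))\<^sup>2 / rho m \<alpha>) has_sum (hnorm m f)\<^sup>2) UNIV"
        using f unfolding hnorm_sq Hm_def by (intro has_sum_infsum) simp
      then show "(sum (\<lambda>\<alpha>. (cmod (f \<alpha>))\<^sup>2 / rho m \<alpha>) \<longlongrightarrow> (hnorm m f)\<^sup>2) ?F" by (simp add: has_sum_def)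
    qed
    have le: "(cmod (T f (\<lambda>_. 0) - (\<Sum>\<beta>\<in>S. f \<beta> * T (zpow \<beta>) (\<lambda>_. 0))))\<^sup>2 \<le> C\<^sup>2 * ((hnorm m f)\<^sup>2 - (\<Sum>\<alpha>\<in>S. (cmod (f \<alpha>))\<^sup>2 / rho m \<alpha>))"
      if S: "finite S" for S
      using C[OF diff_Hm[OF f trunc(1)[OF S, of f]]]
      by (simp add: hnorm_sq_restrict[OF f S] bop_diff[OF T f trunc(1)[OF S, of f]] trunc(2)[OF S])
    \<comment> \<open>By Pythagoras the tails of \<open>f\<close> tend to 0 in norm; boundedness of
      \<open>T\<close> carries this over to the constant coefficients.\<close>
    have "((\<lambda>S. (cmod (T f (\<lambda>_. 0) - (\<Sum>\<beta>\<in>S. f \<beta> * T (zpow \<beta>) (\<lambda>_. 0))))\<^sup>2) \<longlongrightarrow> 0) ?F"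
    proof (rule tendsto_sandwich[OF _ _ tendsto_const])
      show "((\<lambda>S. C\<^sup>2 * ((hnorm m f)\<^sup>2 - (\<Sum>\<alpha>\<in>S. (cmod (f \<alpha>))\<^sup>2 / rho m \<alpha>))) \<longlongrightarrow> 0) ?F"
        using sq by simp
      show "eventually (\<lambda>S. (cmod (T f (\<lambda>_. 0) - (\<Sum>\<beta>\<in>S. f \<beta> * T (zpow \<beta>) (\<lambda>_. 0))))\<^sup>2
          \<le> C\<^sup>2 * ((hnorm m f)\<^sup>2 - (\<Sum>\<alpha>\<in>S. (cmod (f \<alpha>))\<^sup>2 / rho m \<alpha>))) ?F"
        by (rule eventually_finite_subsets_at_top_weakI) (rule le)
    qed simp
    then have "((\<lambda>S. T f (\<lambda>_. 0) - (\<Sum>\<beta>\<in>S. f \<beta> * T (zpow \<beta>) (\<lambda>_. 0))) \<longlongrightarrow> 0) ?F"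
      by (subst (asm) power_tendsto_0_iff) (auto simp: tendsto_norm_zero_iff)
    from tendsto_diff[OF tendsto_const[of "T f (\<lambda>_. 0)"] this]
    have "((\<lambda>\<beta>. f \<beta> * T (zpow \<beta>) (\<lambda>_. 0)) has_sum T f (\<lambda>_. 0)) UNIV"
      by (simp add: has_sum_def)
    moreover have "hinner m f h = (\<Sum>\<^sub>\<infinity>\<beta>. f \<beta> * T (zpow \<beta>) (\<lambda>_. 0))"
      unfolding hinner_def h_def by (rule infsum_cong) simp
    ultimately show "hinner m (T f) one = hinner m f h"
      by (simp add: infsumI one_eq_zpow hinner_zpow_right)
  qed
qed

section \<open>Matrix entries of \<open>T\<close> and the symbol\<close>

theorem theorem4:
  fixes m :: nat and T :: "('n::finite) coeff \<Rightarrow> 'n coeff"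
  assumes "m \<ge> 1"
    and "bop m T"
    and "\<forall>F\<in>Hn m. adjHn m (Mzp m) (T (Mzp m F))
             = PImMzadj m (oplus_op (Sop m T) (PImMzadj m F))"
  shows "toeplitz_pluriharmonic m T (\<lambda>\<alpha>. T one \<alpha> - T0 m T one \<alpha>) (adjH m T one)"
proof -
  note m = assms(1) and T = assms(2)
  define g where "g = (\<lambda>\<alpha>. T one \<alpha> - T0 m T one \<alpha>)"
  define h where "h = adjH m T one"
  have TH: "T f \<in> Hm m" if "f \<in> Hm m" for f using T that unfolding bop_def by blast
  have T1: "T one \<in> Hm m" by (simp add: TH one_eq_zpow)
  have g_eq: "g \<alpha> = (if \<alpha> = (\<lambda>_. 0) then 0 else T one \<alpha>)" for \<alpha>
    unfolding g_def T0_one[of T m, OF T1] by (simp add: one_eq_zpow zpow_def)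
  have gH: "g \<in> Hm m"
    unfolding g_def T0_one[of T m, OF T1] by (intro diff_Hm[OF T1] scale_Hm) (simp add: one_eq_zpow)
  \<comment> \<open>The conjugate of \<open>h\<close> is the row \<alpha> = 0 of the kernel
    coefficients; \<open>g\<close> is the column \<beta> = 0 with the corner removed.\<close>
  have hH: "h \<in> Hm m" and h_eq: "h \<beta> = complex_of_real (rho m \<beta>) * cnj (T (zpow \<beta>) (\<lambda>_. 0))" for \<beta>
    unfolding h_def adjH_one(2)[OF T] using adjH_one(1)[OF T] by simp_all
  have "homogeneous_op T"
    unfolding homogeneous_op_def using bop_scale[OF T] by simp
  note matrix = ddiff_funpow_boundary[OF kernel_coeff_boundary[OF m TH this assms(3)]]
  have entry: "T (zpow \<beta>) \<alpha> = (if \<forall>i. \<beta> i \<le> \<alpha> i then g (\<lambda>i. \<alpha> i - \<beta> i) else 0)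
      + (if \<forall>i. \<alpha> i \<le> \<beta> i then complex_of_real (rho m \<alpha> / rho m \<beta>) * cnj (h (\<lambda>i. \<beta> i - \<alpha> i)) else 0)"
    for \<alpha> \<beta>
  \<comment> \<open>The diagonal \<alpha> = \<beta> satisfies both order conditions. It goes with
    the \<open>h\<close> part, which holds the corner entry, while \<open>g\<close> vanishes at
    0.\<close>
  proof (cases "(\<forall>i. \<beta> i \<le> \<alpha> i) \<and> \<alpha> \<noteq> \<beta>")
    case True
    then have nle: "\<not> (\<forall>i. \<alpha> i \<le> \<beta> i)" by (auto simp: fun_eq_iff intro: antisym)
    then have "\<not> (\<forall>i. \<alpha> i - \<beta> i = 0)" by simp
    then have n0: "(\<lambda>i. \<alpha> i - \<beta> i) \<noteq> (\<lambda>_. 0)" by (simp add: fun_eq_iff)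
    have *: "minf \<alpha> \<beta> = \<beta>" "(\<lambda>i. \<beta> i - \<alpha> i) = (\<lambda>_. 0)" using True by (auto simp: fun_eq_iff)
    have "T (zpow \<beta>) \<alpha> = T one (\<lambda>i. \<alpha> i - \<beta> i)"
      \<comment> \<open>The minimum is \<beta>, so its weight cancels the factor \<rho>(\<beta>) of
        \<open>kernel_coeff\<close>. In the case \<alpha> \<le> \<beta> below it is \<alpha>, which
        leaves the ratio \<rho>(\<alpha>) / \<rho>(\<beta>) of the adjoint.\<close>
      using matrix[of \<alpha> \<beta>] True m unfolding * by (simp add: binom_weight_def kernel_coeff_def one_eq_zpow)
    moreover have "(\<forall>i. \<alpha> i \<le> \<beta> i) = False" using nle by blast
    moreover have "(\<forall>i. \<beta> i \<le> \<alpha> i) = True" using True by blast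
    ultimately show ?thesis using n0 by (simp only: g_eq if_True if_False add_0_right)
  next
    case False
    show ?thesis
    proof (cases "\<forall>i. \<alpha> i \<le> \<beta> i")
      case True
      then have *: "minf \<alpha> \<beta> = \<alpha>" "(\<lambda>i. \<alpha> i - \<beta> i) = (\<lambda>_. 0)" by (auto simp: fun_eq_iff)
      have "complex_of_real (rho m \<beta>) * T (zpow \<beta>) \<alpha> = complex_of_real (rho m \<alpha>) * cnj (h (\<lambda>i. \<beta> i - \<alpha> i))"
        using matrix[of \<alpha> \<beta>] True m unfolding * by (simp add: binom_weight_def kernel_coeff_def h_eq)
      then have "T (zpow \<beta>) \<alpha> = complex_of_real (rho m \<alpha> / rho m \<beta>) * cnj (h (\<lambda>i. \<beta> i - \<alpha> i))"
        by (simp add: field_simps)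
      then show ?thesis using True * by (simp add: g_eq)
    next
      case nle: False
      then have "(\<forall>i. \<beta> i \<le> \<alpha> i) = False" "(\<forall>i. \<alpha> i \<le> \<beta> i) = False" using False by auto
      moreover from this have "complex_of_real (rho m \<beta>) * T (zpow \<beta>) \<alpha> = 0"
        using matrix[of \<alpha> \<beta>] by (simp only: kernel_coeff_def simp_thms if_False mult_zero_right)
      then have "T (zpow \<beta>) \<alpha> = 0" by simp
      ultimately show ?thesis by (simp only: if_False add_0_right)
    qed
  qed
  have "T p = (\<lambda>\<alpha>. cmult g p \<alpha> + Tadj m h p \<alpha>)" if p: "is_poly p" for p
  proof
    fix \<alpha>
    define S where "S = {\<alpha>. p \<alpha> \<noteq> 0}"
    have S: "finite S" "\<And>\<beta>. \<beta> \<notin> S \<Longrightarrow> p \<beta> = 0" using p by (auto simp: is_poly_def S_def)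
    have "(\<lambda>\<alpha>. \<Sum>\<beta>\<in>S. p \<beta> * zpow \<beta> \<alpha>) = p"
      using S(2) by (auto simp: finite_support_expand[OF S(1)])
    then have "T p \<alpha> = (\<Sum>\<beta>\<in>S. p \<beta> * T (zpow \<beta>) \<alpha>)"
      using bop_sum[OF T S(1), of p] by simp
    also have "\<dots> = (\<Sum>\<beta>\<in>S. if \<forall>i. \<beta> i \<le> \<alpha> i then g (\<lambda>i. \<alpha> i - \<beta> i) * p \<beta> else 0)
        + (\<Sum>\<beta>\<in>S. if \<forall>i. \<alpha> i \<le> \<beta> i
            then p \<beta> * complex_of_real (rho m \<alpha> / rho m \<beta>) * cnj (h (\<lambda>i. \<beta> i - \<alpha> i)) else 0)"
      unfolding sum.distrib[symmetric] entry by (rule sum.cong) (simp_all add: distrib_left mult_ac)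
    also have "\<dots> = cmult g p \<alpha> + Tadj m h p \<alpha>"
    proof -
      have "cmult g p \<alpha> = (\<Sum>\<beta>\<in>S. if \<forall>i. \<beta> i \<le> \<alpha> i then g (\<lambda>i. \<alpha> i - \<beta> i) * p \<beta> else 0)"
        by (rule cmult_finite) (use S in auto)
      moreover have "Tadj m h p = (\<lambda>\<alpha>. \<Sum>\<beta>\<in>S. if \<forall>i. \<alpha> i \<le> \<beta> i
            then p \<beta> * complex_of_real (rho m \<alpha> / rho m \<beta>) * cnj (h (\<lambda>i. \<beta> i - \<alpha> i)) else 0)"
        by (rule Tadj_poly[OF m hH]) (use S in auto)
      ultimately show ?thesis by simp
    qed
    finally show "T p \<alpha> = cmult g p \<alpha> + Tadj m h p \<alpha>" .
  qed
  then show ?thesis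
    using T gH hH unfolding toeplitz_pluriharmonic_def g_def h_def by blast
qed

end
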